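(* Let $0<\gamma<n$, $1<p<q<\infty$ and $0<\kappa<p/q$. Given a pair of weights $(w,\nu)$ on $\mathbb R^n$, suppose that for some $r>1$ there is a constant $C<\infty$ such that for all cubes $Q$ in $\mathbb R^n$, $$|Q|^{\gamma/n+1/q-1/p}\cdot\bigg(\frac{1}{|Q|}\int_Q w(x)^r\,dx\bigg)^{1/(rq)}\bigg(\frac{1}{|Q|}\int_Q \nu(x)^{-p'/p}\,dx\bigg)^{1/p'}\leq C.$$ If $w\in\Delta_2$, then the fractional integral operator $I_\gamma$ is bounded from $L^{p,\kappa}(\nu,w)$ into $WL^{q,(\kappa q)/p}(w)$.
   Context: A weight on $\mathbb R^n$ is a nonnegative locally integrable function; for a weight $w$ and a measurable set $E$, $w(E)=\int_E w(x)\,dx$, and $|E|$ is Lebesgue measure. $p'=p/(p-1)$. All cubes have sides parallel to the coordinate axes; $Q(y,\ell)$ is the cube centered at $y$ with side length $\ell>0$, and for $\lambda>0$, $\lambda Q(y,\ell):=Q(y,\lambda\sqrt n\,\ell)$. $w\in\Delta_2$ means: there is a finite constant $C>0$ with $w(2Q)\le C\,w(Q)$ for every cube $Q$. Fractional integral operator: for $0<\gamma<n$, $$I_\gamma f(x)=\frac1{\zeta(\gamma)}\int_{\mathbb R^n}\frac{f(y)}{|x-y|^{n-\gamma}}\,dy,\qquad \zeta(\gamma)=\frac{\pi^{n/2}2^\gamma\Gamma(\gamma/2)}{\Gamma((n-\gamma)/2)}.$$ Weighted Morrey space: for $1<p<\infty$, $0\le\kappa<1$ and weights $w,\nu$, $L^{p,\kappa}(\nu,w)$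 is the set of $f\in L^p_{loc}(\nu)$ with $$\|f\|_{L^{p,\kappa}(\nu,w)}:=\sup_{Q}\bigg(\frac1{w(Q)^\kappa}\int_Q|f(x)|^p\nu(x)\,dx\bigg)^{1/p}<\infty,$$ the supremum being over all cubes $Q$ in $\mathbb R^n$. Weighted weak Morrey space: for $1<p<\infty$, $0\le\kappa<1$ and a weight $w$, $WL^{p,\kappa}(w)$ is the set of measurable $f$ with $$\|f\|_{WL^{p,\kappa}(w)}:=\sup_Q\sup_{\sigma>0}\frac1{w(Q)^{\kappa/p}}\,\sigma\cdot\big[w(\{x\in Q:|f(x)|>\sigma\})\big]^{1/p}<\infty.$$ An operator $T$ is bounded from $X$ into $Y$ if there is a constant $C$ with $\|Tf\|_Y\le C\|f\|_X$ for all $f\in X$. *)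

theory Defs
  imports "HOL-Analysis.Analysis"
begin

text \<open>
  Space \<open>\<real>\<^sup>n\<close> is \<^typ>\<open>real ^ 'n\<close> with \<open>n = CARD('n)\<close>. Norms and weighted measures take values in
  \<^typ>\<open>ennreal\<close>, where \<open>0 * \<infinity> = 0\<close>, \<open>c / 0 = \<infinity>\<close> for \<open>c > 0\<close>, and hence \<open>0 / 0 = 0\<close>.
\<close>

text \<open>
  Real powers on \<open>[0, \<infinity>]\<close>. Unlike \<^const>\<open>powr\<close> on the reals, a negative power of \<open>0\<close> is \<open>\<infinity>\<close>, so that
  \<open>\<nu> powr (- p' / p)\<close> is infinite where \<open>\<nu>\<close> vanishes.
\<close>

definition epowr :: "ennreal \<Rightarrow> real \<Rightarrow> ennreal" where
  "epowr x a =
     (if a = 0 then 1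
      else if x = 0 then (if a < 0 then \<infinity> else 0)
      else if x = \<infinity> then (if a < 0 then 0 else \<infinity>)
      else ennreal (enn2real x powr a))"

definition conj_exp :: "real \<Rightarrow> real" where
  "conj_exp p = p / (p - 1)"

definition cube :: "real ^ 'n \<Rightarrow> real \<Rightarrow> (real ^ 'n) set" where
  "cube y l = cbox (\<chi> i. y $ i - l / 2) (\<chi> i. y $ i + l / 2)"

definition cubes :: "(real ^ 'n) set set" where
  "cubes = {cube y l | y l. 0 < l}"

text \<open>
  The dilate \<open>cQ\<close> of \<open>Q = Q(y, l)\<close>, in the normalisation \<open>cQ = Q(y, c \<surd>n l)\<close> (with the factor \<open>\<surd>n\<close>).
\<close>

definition dilated_cube :: "real \<Rightarrow> real ^ 'n \<Rightarrow> real \<Rightarrow> (real ^ 'n) set" where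
  "dilated_cube c y l = cube y (c * sqrt (real CARD('n)) * l)"

definition weight :: "(real ^ 'n \<Rightarrow> real) \<Rightarrow> bool" where
  "weight w \<longleftrightarrow> w \<in> borel_measurable lebesgue \<and> (\<forall>x. 0 \<le> w x) \<and>
     (\<forall>K. compact K \<longrightarrow> w absolutely_integrable_on K)"

definition wmeas :: "(real ^ 'n \<Rightarrow> real) \<Rightarrow> (real ^ 'n) set \<Rightarrow> ennreal" where
  "wmeas w E = (\<integral>\<^sup>+x\<in>E. ennreal (w x) \<partial>lebesgue)"

definition doubling :: "(real ^ 'n \<Rightarrow> real) \<Rightarrow> bool" where
  "doubling w \<longleftrightarrow> (\<exists>C::real. 0 < C \<and>
     (\<forall>y l. 0 < l \<longrightarrow> wmeas w (dilated_cube 2 y l) \<le> ennreal C * wmeas w (cube y l)))"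

definition average :: "(real ^ 'n \<Rightarrow> ennreal) \<Rightarrow> (real ^ 'n) set \<Rightarrow> ennreal" where
  "average g Q = (\<integral>\<^sup>+x\<in>Q. g x \<partial>lebesgue) / emeasure lebesgue Q"

definition riesz_const :: "nat \<Rightarrow> real \<Rightarrow> real" where
  "riesz_const n \<gamma> =
     pi powr (real n / 2) * 2 powr \<gamma> * Gamma (\<gamma> / 2) / Gamma ((real n - \<gamma>) / 2)"

definition riesz_integrand ::
    "real \<Rightarrow> (real ^ 'n \<Rightarrow> complex) \<Rightarrow> real ^ 'n \<Rightarrow> real ^ 'n \<Rightarrow> complex" where
  "riesz_integrand \<gamma> f x y = f y / of_real (norm (x - y) powr (real CARD('n) - \<gamma>))"

text \<open>
  Where the integral does not converge absolutely, the Bochner integral below is \<open>0\<close> by convention;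
  statements about \<open>frac_integral\<close> should therefore be accompanied by \<open>frac_integral_defined\<close>.
\<close>

definition frac_integral :: "real \<Rightarrow> (real ^ 'n \<Rightarrow> complex) \<Rightarrow> real ^ 'n \<Rightarrow> complex" where
  "frac_integral \<gamma> f x =
     of_real (1 / riesz_const CARD('n) \<gamma>) * (LINT y|lebesgue. riesz_integrand \<gamma> f x y)"

definition frac_integral_defined :: "real \<Rightarrow> (real ^ 'n \<Rightarrow> complex) \<Rightarrow> real ^ 'n \<Rightarrow> bool" where
  "frac_integral_defined \<gamma> f x \<longleftrightarrow> integrable lebesgue (riesz_integrand \<gamma> f x)"

definition morrey_norm ::
    "real \<Rightarrow> real \<Rightarrow> (real ^ 'n \<Rightarrow> real) \<Rightarrow> (real ^ 'n \<Rightarrow> real) \<Rightarrow> (real ^ 'n \<Rightarrow> complex) \<Rightarrow> ennreal"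
  where
  "morrey_norm p \<kappa> \<nu> w f =
     (SUP Q\<in>cubes. epowr
        (1 / epowr (wmeas w Q) \<kappa> * (\<integral>\<^sup>+x\<in>Q. ennreal (norm (f x) powr p * \<nu> x) \<partial>lebesgue)) (1 / p))"

definition Lp_loc :: "real \<Rightarrow> (real ^ 'n \<Rightarrow> real) \<Rightarrow> (real ^ 'n \<Rightarrow> complex) set" where
  "Lp_loc p \<nu> = {f \<in> borel_measurable lebesgue.
     \<forall>K. compact K \<longrightarrow> (\<integral>\<^sup>+x\<in>K. ennreal (norm (f x) powr p * \<nu> x) \<partial>lebesgue) < \<infinity>}"

definition morrey_space ::
    "real \<Rightarrow> real \<Rightarrow> (real ^ 'n \<Rightarrow> real) \<Rightarrow> (real ^ 'n \<Rightarrow> real) \<Rightarrow> (real ^ 'n \<Rightarrow> complex) set" where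
  "morrey_space p \<kappa> \<nu> w = {f \<in> Lp_loc p \<nu>. morrey_norm p \<kappa> \<nu> w f < \<infinity>}"

definition weak_morrey_norm ::
    "real \<Rightarrow> real \<Rightarrow> (real ^ 'n \<Rightarrow> real) \<Rightarrow> (real ^ 'n \<Rightarrow> complex) \<Rightarrow> ennreal" where
  "weak_morrey_norm p \<kappa> w f =
     (SUP Q\<in>cubes. SUP \<sigma>\<in>{0<..}.
        1 / epowr (wmeas w Q) (\<kappa> / p) * ennreal \<sigma> * epowr (wmeas w {x \<in> Q. \<sigma> < norm (f x)}) (1 / p))"

definition weak_morrey_space ::
    "real \<Rightarrow> real \<Rightarrow> (real ^ 'n \<Rightarrow> real) \<Rightarrow> (real ^ 'n \<Rightarrow> complex) set" where
  "weak_morrey_space p \<kappa> w =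
     {f \<in> borel_measurable lebesgue. weak_morrey_norm p \<kappa> w f < \<infinity>}"

definition bounded_operator ::
    "('a \<Rightarrow> 'b) \<Rightarrow> 'a set \<Rightarrow> ('a \<Rightarrow> ennreal) \<Rightarrow> 'b set \<Rightarrow> ('b \<Rightarrow> ennreal) \<Rightarrow> bool" where
  "bounded_operator T X normX Y normY \<longleftrightarrow>
     (\<forall>f\<in>X. T f \<in> Y) \<and> (\<exists>C::real. \<forall>f\<in>X. normY (T f) \<le> ennreal C * normX f)"

end

theory Submission
  imports Defs
begin

text \<open>
  The proof is a Hedberg-type argument in which the power bump replaces the weight. For a cube \<open>Q\<close> of
  side \<open>l\<close> put \<open>W(Q) = |Q|^(1 - 1/r) (\<integral>\<^sub>Q w^r)^(1/r)\<close>. Hoelder's inequality gives \<open>w(Q) \<le> W(Q)\<close>, and since \<open>r > 1\<close> the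
  values of \<open>W\<close> on concentric cubes of sides \<open>2^j l\<close> grow geometrically, even if \<open>w\<close> itself grows slowly.
  By the bump condition, \<open>l^(\<gamma> - n) \<integral>\<^sub>Q |f| \<le> C W(Q)^(-1/q) (\<integral>\<^sub>Q |f|^p \<nu>)^(1/p)\<close> (\<open>bump_functional_exists\<close>).

  The kernel is split into dyadic scales around \<open>x\<close> (\<open>riesz_majorant_le_dyadic\<close>). Fix a cube \<open>Q\<close> and a
  function \<open>f\<close> of Morrey norm at most \<open>N\<close>. For \<open>x\<close> in \<open>Q\<close>, the scales above the side of \<open>Q\<close> form a geometric
  series with sum at most \<open>C N w(Q)^(\<kappa>/p - 1/q)\<close>, because \<open>\<kappa> / p < 1 / q\<close> (\<open>far_sum_le\<close>). Levels \<open>\<sigma>\<close> of this size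
  satisfy the weak bound trivially. For larger \<open>\<sigma>\<close> the small scales must be large, and they see only the
  energy \<open>F^p = \<integral> |f|^p \<nu> \<le> C N^p w(Q)^\<kappa>\<close> over the cube of twice the side. If the energy on each small cube \<open>R\<close> around \<open>x\<close>
  were at most \<open>\<lambda>^p W(R)\<close>, then the sum over the small scales would be at most \<open>C F^(1 - p/q) \<lambda>^(p/q)\<close>, by the
  lacunarity of \<open>W\<close> and \<open>p < q\<close> (\<open>near_sum_le\<close>). With \<open>\<lambda>\<close> adjusted to \<open>\<sigma>\<close>, each point of the level set is
  therefore the centre of a cube \<open>R\<close> with \<open>\<lambda>^p w(R) \<le> \<integral>\<^sub>R |f|^p \<nu>\<close>. Vitali's covering lemma and the doubling of
  \<open>w\<close> bound the \<open>w\<close>-measure of the level set by \<open>C (F / \<sigma>)^q\<close> (\<open>wmeas_le_of_cube_cover\<close>, \<open>weak_type_estimate\<close>),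
  which is the weak Morrey bound on \<open>Q\<close>.

  All of this is done for the integral of the absolute value of the integrand. Convergence of the
  fractional integral at \<open>w\<close>-almost every point follows by letting \<open>\<sigma>\<close> tend to infinity. If \<open>w\<close>
  vanishes on a cube, it vanishes almost everywhere by doubling, and there is nothing to prove beyond
  measurability.
\<close>

section \<open>Sums of lacunary sequences\<close>

lemma sum_geometric_decay_le:
  fixes b :: "nat \<Rightarrow> real"
  assumes "0 \<le> \<theta>" "\<theta> < 1" "\<And>j. 0 \<le> b j" "\<And>j. b (Suc j) \<le> \<theta> * b j"
  shows "(\<Sum>j<m. b j) \<le> b 0 / (1 - \<theta>)"
  using assms(3,4)
proof (induction m arbitrary: b)
  case 0
  then show ?case using assms(1,2) by simp
next
  case (Suc m)
  have "(\<Sum>j<Suc m. b j) = b 0 + (\<Sum>j<m. b (Suc j))"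
    by (rule sum.lessThan_Suc_shift)
  also have "\<dots> \<le> b 0 + b (Suc 0) / (1 - \<theta>)"
    using Suc.IH[of "\<lambda>j. b (Suc j)"] Suc.prems by simp
  also have "\<dots> \<le> b 0 + \<theta> * b 0 / (1 - \<theta>)"
    using Suc.prems(2)[of 0] assms(2) by (simp add: divide_right_mono)
  also have "\<dots> = b 0 / (1 - \<theta>)"
    using assms(2) by (simp add: field_simps)
  finally show ?case .
qed

text \<open>
  The bound is uniform over all sequences that decrease at least geometrically: the terms with
  \<open>t j \<ge> 1\<close> are dominated by a geometric series that ends at the last such index, those with
  \<open>t j < 1\<close> by one that begins at the first such index.
\<close>

lemma sum_lacunary_min_bounded:
  fixes \<rho> a b :: real
  assumes \<rho>: "1 < \<rho>" and a: "0 < a" and b: "0 < b"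
  obtains C where "0 < C"
    "\<And>(t::nat \<Rightarrow> real) m. (\<And>j. 0 < t j) \<Longrightarrow> (\<And>j. \<rho> * t (Suc j) \<le> t j) \<Longrightarrow>
       (\<Sum>j<m. min (t j powr (- a)) (t j powr b)) \<le> C"
proof
  define ca where "ca = 1 / (1 - \<rho> powr (- a))"
  define cb where "cb = 1 / (1 - \<rho> powr (- b))"
  have pa: "0 < \<rho> powr (- a)" "\<rho> powr (- a) < 1" and pb: "0 < \<rho> powr (- b)" "\<rho> powr (- b) < 1"
    using \<rho> a b by (auto intro!: powr_less_one)
  have ca: "1 + \<rho> powr (- a) * ca = ca" "0 < ca" and cb: "1 + \<rho> powr (- b) * cb = cb" "0 < cb"
    using pa pb by (simp_all add: ca_def cb_def field_simps)
  show "0 < ca + cb" using ca cb by simp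
  fix t :: "nat \<Rightarrow> real" and m
  assume pos: "\<And>j. 0 < t j" and lac: "\<And>j. \<rho> * t (Suc j) \<le> t j"
  have powa: "t j powr (- a) \<le> \<rho> powr (- a) * t (Suc j) powr (- a)" for j
    using powr_mono2'[of "-a" "\<rho> * t (Suc j)" "t j"] a lac[of j] pos[of "Suc j"] \<rho>
    by (simp add: powr_mult)
  have large: "(\<Sum>j<m. if 1 \<le> t j then t j powr (- a) else 0) \<le> ca \<and>
      (1 \<le> t m \<longrightarrow> (\<Sum>j<m. if 1 \<le> t j then t j powr (- a) else 0) \<le> ca * \<rho> powr (- a) * t m powr (- a))"
    for m
  proof (induction m)
    case 0
    then show ?case using ca pa by simp
  next
    case (Suc m)
    have *: "(\<Sum>j<Suc m. if 1 \<le> t j then t j powr (- a) else 0) \<le> ca * t m powr (- a)" if "1 \<le> t m"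
    proof -
      have "(\<Sum>j<Suc m. if 1 \<le> t j then t j powr (- a) else 0)
          \<le> ca * \<rho> powr (- a) * t m powr (- a) + t m powr (- a)"
        using Suc that by simp
      also have "\<dots> = (1 + \<rho> powr (- a) * ca) * t m powr (- a)"
        by (simp add: algebra_simps)
      also have "\<dots> = ca * t m powr (- a)" using ca by simp
      finally show ?thesis .
    qed
    show ?case
    proof (cases "1 \<le> t m")
      case True
      have "t m powr (- a) \<le> 1"
        using powr_mono2'[of "-a" 1 "t m"] a True by simp
      then have "ca * t m powr (- a) \<le> ca" using ca by (simp add: mult_le_cancel_left1)
      moreover have "ca * t m powr (- a) \<le> ca * \<rho> powr (- a) * t (Suc m) powr (- a)"
        using powa[of m] ca by simp
      ultimately show ?thesis using *[OF True] by linarith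
    next
      case False
      have "t (Suc m) \<le> \<rho> * t (Suc m)" using \<rho> pos[of "Suc m"] by simp
      then have "\<not> 1 \<le> t (Suc m)" using lac[of m] False by linarith
      then show ?thesis using Suc False by simp
    qed
  qed
  have small: "(\<Sum>j<m. if t j < 1 then t j powr b else 0) \<le> cb \<and>
      (t 0 < 1 \<longrightarrow> (\<Sum>j<m. if t j < 1 then t j powr b else 0) \<le> cb * t 0 powr b)"
    if "\<And>j. 0 < t j" "\<And>j. \<rho> * t (Suc j) \<le> t j" for t :: "nat \<Rightarrow> real"
    using that
  proof (induction m arbitrary: t)
    case 0
    then show ?case using cb by simp
  next
    case (Suc m)
    have IH: "(\<Sum>j<m. if t (Suc j) < 1 then t (Suc j) powr b else 0) \<le> cb"
      "t (Suc 0) < 1 \<Longrightarrow> (\<Sum>j<m. if t (Suc j) < 1 then t (Suc j) powr b else 0) \<le> cb * t (Suc 0) powr b"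
      using Suc.IH[of "\<lambda>j. t (Suc j)"] Suc.prems by auto
    have split: "(\<Sum>j<Suc m. if t j < 1 then t j powr b else 0) =
       (if t 0 < 1 then t 0 powr b else 0) + (\<Sum>j<m. if t (Suc j) < 1 then t (Suc j) powr b else 0)"
      by (rule sum.lessThan_Suc_shift)
    show ?case
    proof (cases "t 0 < 1")
      case True
      have le: "\<rho> * t (Suc 0) \<le> t 0" "0 < t (Suc 0)" using Suc.prems by auto
      have "t (Suc 0) \<le> \<rho> * t (Suc 0)" using \<rho> le by simp
      then have lt: "t (Suc 0) < 1" using True le by linarith
      have "\<rho> powr b * t (Suc 0) powr b \<le> t 0 powr b"
        using powr_mono2[of b "\<rho> * t (Suc 0)" "t 0"] le b \<rho> by (simp add: powr_mult)
      then have "t (Suc 0) powr b \<le> \<rho> powr (- b) * t 0 powr b"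
        using \<rho> by (simp add: powr_minus field_simps)
      then have "cb * t (Suc 0) powr b \<le> cb * (\<rho> powr (- b) * t 0 powr b)"
        using cb by simp
      then have "(\<Sum>j<Suc m. if t j < 1 then t j powr b else 0) \<le> (1 + \<rho> powr (- b) * cb) * t 0 powr b"
        using split IH(2)[OF lt] True by (simp add: algebra_simps)
      then have 1: "(\<Sum>j<Suc m. if t j < 1 then t j powr b else 0) \<le> cb * t 0 powr b"
        using cb by simp
      have "t 0 powr b \<le> 1" using powr_mono2[of b "t 0" 1] True b Suc.prems(1)[of 0] by simp
      then have "cb * t 0 powr b \<le> cb" using cb by (simp add: mult_le_cancel_left1)
      then show ?thesis using 1 by linarith
    next
      case False
      then show ?thesis using split IH(1) by simp
    qed
  qed
  have "(\<Sum>j<m. min (t j powr (- a)) (t j powr b))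
      \<le> (\<Sum>j<m. (if 1 \<le> t j then t j powr (- a) else 0) + (if t j < 1 then t j powr b else 0))"
    by (intro sum_mono) auto
  also have "\<dots> \<le> ca + cb"
    using large[of m] small[of t] pos lac by (simp add: sum.distrib)
  finally show "(\<Sum>j<m. min (t j powr (- a)) (t j powr b)) \<le> ca + cb" .
qed

lemma suminf_ennreal_le:
  fixes g :: "nat \<Rightarrow> real"
  assumes "\<And>j. 0 \<le> g j" "\<And>m. (\<Sum>j<m. g j) \<le> c"
  shows "(\<Sum>j. ennreal (g j)) \<le> ennreal c"
proof (rule suminf_le_const)
  show "(\<Sum>j<m. ennreal (g j)) \<le> ennreal c" for m
    using assms by (subst sum_ennreal) (auto intro: ennreal_leI)
qed (rule summableI)

section \<open>Hoelder's inequality\<close>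

lemma powr_mult_powr_le:
  fixes x y \<theta> :: real
  assumes "0 \<le> x" "0 \<le> y" "0 < \<theta>" "\<theta> < 1"
  shows "x powr \<theta> * y powr (1 - \<theta>) \<le> \<theta> * x + (1 - \<theta>) * y"
  using Youngs_inequality_0[of \<theta> "1 - \<theta>" x y] assms by (cases "x = 0 \<or> y = 0") auto

lemma nn_integral_Holder:
  fixes f g :: "'a \<Rightarrow> real"
  assumes [measurable]: "f \<in> borel_measurable M" "g \<in> borel_measurable M"
    and nn: "\<And>x. 0 \<le> f x" "\<And>x. 0 \<le> g x" and \<theta>: "0 < \<theta>" "\<theta> < 1"
    and AB: "0 \<le> A" "0 \<le> B"
    and fA: "(\<integral>\<^sup>+x. ennreal (f x) \<partial>M) \<le> ennreal A"
    and gB: "(\<integral>\<^sup>+x. ennreal (g x) \<partial>M) \<le> ennreal B"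
  shows "(\<integral>\<^sup>+x. ennreal (f x powr \<theta> * g x powr (1 - \<theta>)) \<partial>M) \<le> ennreal (A powr \<theta> * B powr (1 - \<theta>))"
proof (cases "A = 0 \<or> B = 0")
  case True
  have "AE x in M. f x powr \<theta> * g x powr (1 - \<theta>) = 0"
  proof (cases "A = 0")
    case True
    then have "(\<integral>\<^sup>+x. ennreal (f x) \<partial>M) = 0" using fA by simp
    then have "AE x in M. ennreal (f x) = 0" by (subst (asm) nn_integral_0_iff_AE) auto
    then show ?thesis by eventually_elim (use nn in \<open>auto simp: ennreal_eq_0_iff\<close>, metis nn(1) order_antisym powr_0)
  next
    case False
    then have "(\<integral>\<^sup>+x. ennreal (g x) \<partial>M) = 0" using gB \<open>A = 0 \<or> B = 0\<close> by simp
    then have "AE x in M. ennreal (g x) = 0" by (subst (asm) nn_integral_0_iff_AE) auto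
    then show ?thesis by eventually_elim (use nn in \<open>auto simp: ennreal_eq_0_iff\<close>, metis nn(2) order_antisym powr_0)
  qed
  then have "(\<integral>\<^sup>+x. ennreal (f x powr \<theta> * g x powr (1 - \<theta>)) \<partial>M) = 0"
    by (subst nn_integral_0_iff_AE) auto
  then show ?thesis by simp
next
  case False
  then have pos: "0 < A" "0 < B" using AB by auto
  define c where "c = A powr \<theta> * B powr (1 - \<theta>)"
  have c: "0 < c" using pos by (simp add: c_def)
  have pt: "f x powr \<theta> * g x powr (1 - \<theta>) \<le> c * (\<theta> / A * f x + (1 - \<theta>) / B * g x)" for x
  proof -
    have "f x powr \<theta> * g x powr (1 - \<theta>) = c * ((f x / A) powr \<theta> * (g x / B) powr (1 - \<theta>))"
      using pos nn by (simp add: c_def powr_divide)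
    also have "\<dots> \<le> c * (\<theta> * (f x / A) + (1 - \<theta>) * (g x / B))"
      using pos nn \<theta> c by (intro mult_left_mono powr_mult_powr_le) auto
    finally show ?thesis by simp
  qed
  have "(\<integral>\<^sup>+x. ennreal (f x powr \<theta> * g x powr (1 - \<theta>)) \<partial>M)
      \<le> (\<integral>\<^sup>+x. ennreal (c * \<theta> / A) * ennreal (f x) + ennreal (c * (1 - \<theta>) / B) * ennreal (g x) \<partial>M)"
  proof (rule nn_integral_mono)
    fix x
    have "ennreal (f x powr \<theta> * g x powr (1 - \<theta>)) \<le> ennreal (c * \<theta> / A * f x + c * (1 - \<theta>) / B * g x)"
      using pt[of x] by (intro ennreal_leI) (simp add: distrib_left mult.assoc)
    also have "\<dots> = ennreal (c * \<theta> / A) * ennreal (f x) + ennreal (c * (1 - \<theta>) / B) * ennreal (g x)"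
      using c pos nn[of x] \<theta> by (subst ennreal_plus) (auto simp: ennreal_mult[symmetric])
    finally show "ennreal (f x powr \<theta> * g x powr (1 - \<theta>)) \<le> \<dots>" .
  qed
  also have "\<dots> = ennreal (c * \<theta> / A) * (\<integral>\<^sup>+x. ennreal (f x) \<partial>M) + ennreal (c * (1 - \<theta>) / B) * (\<integral>\<^sup>+x. ennreal (g x) \<partial>M)"
    by (simp add: nn_integral_add nn_integral_cmult)
  also have "\<dots> \<le> ennreal (c * \<theta> / A) * ennreal A + ennreal (c * (1 - \<theta>) / B) * ennreal B"
    using fA gB by (intro add_mono mult_left_mono) auto
  also have "\<dots> = ennreal c"
    using pos c \<theta> by (simp add: ennreal_mult'[symmetric] ennreal_plus[symmetric] del: ennreal_plus)
       (simp add: algebra_simps)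
  finally show ?thesis by (simp add: c_def)
qed

section \<open>Cubes\<close>

lemma mem_cube: "x \<in> cube y l \<longleftrightarrow> (\<forall>i. \<bar>x $ i - y $ i\<bar> \<le> l / 2)"
proof -
  have "(y $ i - l / 2 \<le> x $ i \<and> x $ i \<le> y $ i + l / 2) \<longleftrightarrow> \<bar>x $ i - y $ i\<bar> \<le> l / 2" for i
    by arith
  then show ?thesis by (simp add: cube_def mem_box_cart)
qed

lemma sets_cube [measurable]: "cube y l \<in> sets lebesgue"
  by (simp add: cube_def)

lemma compact_cube: "compact (cube y l)"
  by (simp add: cube_def)

lemma cube_mono: "l \<le> l' \<Longrightarrow> cube y l \<subseteq> cube y l'"
  unfolding subset_iff mem_cube by (meson divide_right_mono order_trans zero_le_numeral)

lemma cube_subset_cube: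
  assumes "x \<in> cube y l" "l + s \<le> l'"
  shows "cube x s \<subseteq> cube y l'"
proof
  fix z assume z: "z \<in> cube x s"
  show "z \<in> cube y l'" unfolding mem_cube
  proof
    fix i
    have "\<bar>x $ i - y $ i\<bar> \<le> l / 2" "\<bar>z $ i - x $ i\<bar> \<le> s / 2"
      using assms z by (auto simp: mem_cube)
    then show "\<bar>z $ i - y $ i\<bar> \<le> l' / 2" using assms(2) by linarith
  qed
qed

lemma mem_cube_commute: "x \<in> cube y l \<longleftrightarrow> y \<in> cube x l"
  by (simp add: mem_cube abs_minus_commute)

lemma cball_subset_cube: "cball y (l / 2) \<subseteq> cube y l"
proof
  fix z assume "z \<in> cball y (l / 2)"
  then have "norm (z - y) \<le> l / 2" by (simp add: dist_norm norm_minus_commute)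
  then show "z \<in> cube y l" unfolding mem_cube
    using component_le_norm_cart[of "z - y"] by (metis order_trans vector_minus_component)
qed

lemma cube_subset_cball:
  fixes y :: "real ^ 'n"
  assumes "0 \<le> l"
  shows "cube y l \<subseteq> cball y (sqrt (real CARD('n)) * l / 2)"
proof
  fix z assume z: "z \<in> cube y l"
  have "norm (z - y) = sqrt (\<Sum>i\<in>UNIV. ((z - y) $ i)\<^sup>2)"
    by (simp add: norm_vec_def L2_set_def)
  also have "\<dots> \<le> sqrt (\<Sum>i\<in>(UNIV::'n set). (l / 2)\<^sup>2)"
    using z assms unfolding mem_cube
    by (intro real_sqrt_le_mono sum_mono) (simp add: abs_le_square_iff[symmetric])
  also have "\<dots> = sqrt (real CARD('n)) * l / 2"
    using assms by (simp add: real_sqrt_mult real_sqrt_divide)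
  finally show "z \<in> cball y (sqrt (real CARD('n)) * l / 2)" by (simp add: dist_norm norm_minus_commute)
qed

lemma emeasure_cube:
  fixes y :: "real ^ 'n"
  assumes "0 < l"
  shows "emeasure lebesgue (cube y l) = ennreal (l ^ CARD('n))"
proof -
  have ne: "cbox (\<chi> i. y $ i - l / 2) (\<chi> i. y $ i + l / 2) \<noteq> {}"
    using assms by (auto simp: interval_ne_empty_cart)
  have "emeasure lebesgue (cube y l) = ennreal (measure lborel (cube y l))"
    using emeasure_lborel_cbox_finite[where 'a = "real ^ 'n", THEN less_imp_neq] unfolding cube_def infinity_ennreal_def
    by (simp add: emeasure_eq_ennreal_measure del: emeasure_lborel_cbox)
  also have "measure lborel (cube y l) = l ^ CARD('n)"
    using content_cbox_cart[OF ne] unfolding cube_def by simp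
  finally show ?thesis .
qed

lemma Union_cubes_nat: "(\<Union>m. cube y (real (Suc m))) = UNIV"
proof -
  have "x \<in> (\<Union>m. cube y (real (Suc m)))" for x
  proof -
    obtain m where m: "2 * norm (x - y) \<le> real m" using real_arch_simple by blast
    have "x \<in> cball y (real (Suc m) / 2)"
      using m by (simp add: dist_norm norm_minus_commute)
    then show ?thesis using cball_subset_cube by blast
  qed
  then show ?thesis by auto
qed

section \<open>Coverings by cubes and doubling weights\<close>

lemma wmeas_mono: "E \<subseteq> F \<Longrightarrow> wmeas w E \<le> wmeas w F"
  unfolding wmeas_def by (intro nn_integral_mono) (auto split: split_indicator)

lemma set_nn_integral_UN_le:
  assumes [measurable]: "h \<in> borel_measurable M" and C: "countable C"
    and B: "\<And>i. i \<in> C \<Longrightarrow> B i \<in> sets M"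
  shows "(\<integral>\<^sup>+x\<in>(\<Union>i\<in>C. B i). h x \<partial>M) \<le> (\<integral>\<^sup>+i. (\<integral>\<^sup>+x\<in>B i. h x \<partial>M) \<partial>count_space C)"
proof -
  have "(\<integral>\<^sup>+x\<in>(\<Union>i\<in>C. B i). h x \<partial>M) \<le> (\<integral>\<^sup>+x. (\<integral>\<^sup>+i. h x * indicator (B i) x \<partial>count_space C) \<partial>M)"
  proof (rule nn_integral_mono)
    fix x
    show "h x * indicator (\<Union>i\<in>C. B i) x \<le> (\<integral>\<^sup>+i. h x * indicator (B i) x \<partial>count_space C)"
    proof (cases "x \<in> (\<Union>i\<in>C. B i)")
      case True
      then obtain j where j: "j \<in> C" "x \<in> B j" by blast
      then show ?thesis
        using nn_integral_ge_point[of j C "\<lambda>i. h x * indicator (B i) x"] True by simp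
    qed simp
  qed
  also have "\<dots> = (\<integral>\<^sup>+i. (\<integral>\<^sup>+x\<in>B i. h x \<partial>M) \<partial>count_space C)"
    using C B by (intro nn_integral_count_space_nn_integral) auto
  finally show ?thesis .
qed

lemma set_nn_integral_disjoint_le:
  assumes [measurable]: "h \<in> borel_measurable M" and C: "countable C"
    and B: "\<And>i. i \<in> C \<Longrightarrow> B i \<in> sets M" and S: "\<And>i. i \<in> C \<Longrightarrow> B i \<subseteq> S"
    and disj: "disjoint_family_on B C"
  shows "(\<integral>\<^sup>+i. (\<integral>\<^sup>+x\<in>B i. h x \<partial>M) \<partial>count_space C) \<le> (\<integral>\<^sup>+x\<in>S. h x \<partial>M)"
proof -
  have "(\<integral>\<^sup>+i. (\<integral>\<^sup>+x\<in>B i. h x \<partial>M) \<partial>count_space C) = (\<integral>\<^sup>+x. (\<integral>\<^sup>+i. h x * indicator (B i) x \<partial>count_space C) \<partial>M)"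
    using C B by (intro nn_integral_count_space_nn_integral[symmetric]) auto
  also have "\<dots> \<le> (\<integral>\<^sup>+x\<in>S. h x \<partial>M)"
  proof (rule nn_integral_mono)
    fix x
    show "(\<integral>\<^sup>+i. h x * indicator (B i) x \<partial>count_space C) \<le> h x * indicator S x"
    proof (cases "\<exists>j\<in>C. x \<in> B j")
      case True
      then obtain j where j: "j \<in> C" "x \<in> B j" by blast
      have "indicator (B i) x = (indicator {j} i :: ennreal)" if "i \<in> C" for i
        using disj j that by (auto simp: disjoint_family_on_def split: split_indicator)
      then have "(\<integral>\<^sup>+i. h x * indicator (B i) x \<partial>count_space C) = (\<integral>\<^sup>+i. h x * indicator {j} i \<partial>count_space C)"
        by (intro nn_integral_cong) simp
      also have "\<dots> = h x" using j by (simp add: nn_integral_cmult_indicator)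
      finally show ?thesis using j S by (auto split: split_indicator)
    next
      case False
      then have "(\<integral>\<^sup>+i. h x * indicator (B i) x \<partial>count_space C) = (\<integral>\<^sup>+i. 0 \<partial>count_space C)"
        by (intro nn_integral_cong) (auto split: split_indicator)
      then show ?thesis by simp
    qed
  qed
  finally show ?thesis .
qed

lemma wmeas_dilate_le:
  fixes y :: "real ^ 'n" and w :: "real ^ 'n \<Rightarrow> real"
  assumes D: "0 < D" "\<And>y l. 0 < l \<Longrightarrow> wmeas w (dilated_cube 2 y l) \<le> ennreal D * wmeas w (cube y l)"
    and l: "0 < l"
  shows "wmeas w (cube y (2 ^ k * l)) \<le> ennreal (D ^ k) * wmeas w (cube y l)"
proof (induction k)
  case (Suc k)
  have "1 \<le> sqrt (real CARD('n))" by simp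
  then have "1 * (2 * (2 ^ k * l)) \<le> sqrt (real CARD('n)) * (2 * (2 ^ k * l))"
    using l by (intro mult_right_mono) auto
  then have "cube y (2 ^ Suc k * l) \<subseteq> dilated_cube 2 y (2 ^ k * l)"
    unfolding dilated_cube_def by (intro cube_mono) (simp add: algebra_simps)
  then have "wmeas w (cube y (2 ^ Suc k * l)) \<le> wmeas w (dilated_cube 2 y (2 ^ k * l))"
    by (rule wmeas_mono)
  also have "\<dots> \<le> ennreal D * wmeas w (cube y (2 ^ k * l))" using D(2) l by simp
  also have "\<dots> \<le> ennreal D * (ennreal (D ^ k) * wmeas w (cube y l))"
    using Suc by (intro mult_left_mono) auto
  finally show ?case using D(1) by (simp add: ennreal_mult mult.assoc)
qed simp

text \<open>
  The weak-type bound of the maximal function with respect to \<open>w\<close>: Vitali's lemma, applied to the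
  balls circumscribed about the given cubes, selects disjoint cubes, and three doublings absorb
  the enlargement of the balls by the factor \<open>5\<close>. The set \<open>E\<close> need not be measurable.
\<close>

lemma wmeas_le_of_cube_cover:
  fixes w :: "real ^ 'n \<Rightarrow> real" and h :: "real ^ 'n \<Rightarrow> ennreal"
  assumes w [measurable]: "w \<in> borel_measurable lebesgue" and h [measurable]: "h \<in> borel_measurable lebesgue"
    and D: "0 < D" "\<And>y l. 0 < l \<Longrightarrow> wmeas w (dilated_cube 2 y l) \<le> ennreal D * wmeas w (cube y l)"
    and E: "\<And>x. x \<in> E \<Longrightarrow> \<exists>s. 0 < s \<and> s \<le> L \<and> cube x s \<subseteq> S \<and>
              c * wmeas w (cube x s) \<le> (\<integral>\<^sup>+y\<in>cube x s. h y \<partial>lebesgue)"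
  shows "c * wmeas w E \<le> ennreal (D ^ 3) * (\<integral>\<^sup>+y\<in>S. h y \<partial>lebesgue)"
proof -
  let ?n = "sqrt (real CARD('n))"
  have n1: "1 \<le> ?n" by simp
  have "\<forall>x\<in>E. \<exists>s. 0 < s \<and> s \<le> L \<and> cube x s \<subseteq> S \<and> c * wmeas w (cube x s) \<le> (\<integral>\<^sup>+y\<in>cube x s. h y \<partial>lebesgue)"
    using E by blast
  from bchoice[OF this] obtain s where s: "\<And>x. x \<in> E \<Longrightarrow> 0 < s x" "\<And>x. x \<in> E \<Longrightarrow> s x \<le> L" "\<And>x. x \<in> E \<Longrightarrow> cube x (s x) \<subseteq> S"
    "\<And>x. x \<in> E \<Longrightarrow> c * wmeas w (cube x (s x)) \<le> (\<integral>\<^sup>+y\<in>cube x (s x). h y \<partial>lebesgue)"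
    by blast
  define r where "r x = ?n * s x / 2" for x
  have r: "0 < r x \<and> r x \<le> ?n * L / 2" if "x \<in> E" for x
    using s[OF that] n1 by (auto simp: r_def intro!: mult_left_mono)
  have cov: "E \<subseteq> (\<Union>x\<in>E. cball x (r x))"
  proof
    fix x assume x: "x \<in> E"
    then have "x \<in> cball x (r x)" using r[OF x] by simp
    then show "x \<in> (\<Union>x\<in>E. cball x (r x))" using x by blast
  qed
  obtain C where C: "countable C" "C \<subseteq> E"
     "pairwise (\<lambda>i j. disjnt (cball i (r i)) (cball j (r j))) C"
     "E \<subseteq> (\<Union>i\<in>C. cball i (5 * r i))"
    by (rule Vitali_covering_lemma_cballs[OF cov r]) (assumption, rule that)
  have sub: "cube i (s i) \<subseteq> cball i (r i)" if "i \<in> C" for i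
    using that C(2) s(1)[of i] cube_subset_cball[of "s i" i] unfolding r_def by (simp add: less_imp_le subset_iff)
  have disj: "disjoint_family_on (\<lambda>i. cube i (s i)) C"
    unfolding disjoint_family_on_def
  proof (intro ballI impI)
    fix i j assume ij: "i \<in> C" "j \<in> C" "i \<noteq> j"
    then have "disjnt (cball i (r i)) (cball j (r j))" using C(3) by (auto simp: pairwise_def)
    moreover have "cube i (s i) \<subseteq> cball i (r i)" "cube j (s j) \<subseteq> cball j (r j)"
      using ij(1,2) by (simp_all add: sub)
    ultimately show "cube i (s i) \<inter> cube j (s j) = {}" by (auto simp: disjnt_def)
  qed
  have big: "wmeas w (cball i (5 * r i)) \<le> ennreal (D ^ 3) * wmeas w (cube i (s i))" if "i \<in> C" for i
  proof -
    let ?d = "\<lambda>l. 2 * ?n * l"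
    have si: "0 < s i" using that C(2) s(1) by auto
    have iter: "wmeas w (cube i (?d l)) \<le> ennreal D * wmeas w (cube i l)" if "0 < l" for l
      using D(2)[OF that, of i] by (simp add: dilated_cube_def)
    \<comment> \<open>Each doubling multiplies the side by \<open>2 \<surd>n\<close>, and \<open>(2 \<surd>n)^3 \<ge> 5 \<surd>n\<close>.\<close>
    have "5 * ?n * s i \<le> ?d (?d (?d (s i)))"
    proof -
      have "5 * (?n * s i) \<le> (8 * ?n\<^sup>2) * (?n * s i)"
      proof (intro mult_right_mono)
        have "1 \<le> CARD('n)" by (simp add: Suc_leI)
        then have "1 \<le> real CARD('n)" by linarith
        moreover have "?n\<^sup>2 = real CARD('n)" by simp
        ultimately show "5 \<le> 8 * ?n\<^sup>2" by linarith
      qed (use si in simp)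
      also have "\<dots> = ?d (?d (?d (s i)))" by (simp add: power2_eq_square mult_ac del: real_sqrt_mult_self real_sqrt_pow2)
      finally show ?thesis by (simp only: mult.assoc)
    qed
    then have "cball i (5 * r i) \<subseteq> cube i (?d (?d (?d (s i))))"
      using cball_subset_cube[of i "5 * ?n * s i"] cube_mono[of "5 * ?n * s i" "?d (?d (?d (s i)))" i]
      unfolding r_def by (simp add: mult.assoc)
    then have "wmeas w (cball i (5 * r i)) \<le> wmeas w (cube i (?d (?d (?d (s i)))))"
      by (rule wmeas_mono)
    also have "\<dots> \<le> ennreal D * wmeas w (cube i (?d (?d (s i))))"
      using si n1 by (intro iter) simp
    also have "\<dots> \<le> ennreal D * (ennreal D * wmeas w (cube i (?d (s i))))"
      using si n1 by (intro mult_left_mono iter) simp_all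
    also have "\<dots> \<le> ennreal D * (ennreal D * (ennreal D * wmeas w (cube i (s i))))"
      using si n1 by (intro mult_left_mono iter) simp_all
    also have "\<dots> = ennreal (D ^ 3) * wmeas w (cube i (s i))"
      using D(1) by (simp add: power3_eq_cube ennreal_mult mult.assoc)
    finally show ?thesis .
  qed
  have "c * wmeas w E \<le> c * wmeas w (\<Union>i\<in>C. cball i (5 * r i))"
    by (intro mult_left_mono wmeas_mono C(4)) auto
  also have "\<dots> \<le> c * (\<integral>\<^sup>+i. wmeas w (cball i (5 * r i)) \<partial>count_space C)"
    unfolding wmeas_def by (intro mult_left_mono set_nn_integral_UN_le C(1)) auto
  also have "\<dots> \<le> c * (\<integral>\<^sup>+i. ennreal (D ^ 3) * wmeas w (cube i (s i)) \<partial>count_space C)"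
    by (intro mult_left_mono nn_integral_mono) (auto simp: big)
  also have "\<dots> = ennreal (D ^ 3) * (\<integral>\<^sup>+i. c * wmeas w (cube i (s i)) \<partial>count_space C)"
    by (simp add: nn_integral_cmult mult.left_commute)
  also have "\<dots> \<le> ennreal (D ^ 3) * (\<integral>\<^sup>+i. (\<integral>\<^sup>+y\<in>cube i (s i). h y \<partial>lebesgue) \<partial>count_space C)"
    using C(2) s(4) by (intro mult_left_mono nn_integral_mono) auto
  also have "\<dots> \<le> ennreal (D ^ 3) * (\<integral>\<^sup>+y\<in>S. h y \<partial>lebesgue)"
    using C(2) s(3) by (intro mult_left_mono set_nn_integral_disjoint_le C(1) disj) auto
  finally show ?thesis .
qed

section \<open>Dyadic decomposition of the Riesz kernel\<close>

text \<open>
  The integral of the absolute value of the Riesz integrand, without the normalising constant. It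
  is defined for every function, possibly infinite, and up to a constant dominates the fractional integral.
\<close>

definition riesz_majorant :: "real \<Rightarrow> (real ^ 'n \<Rightarrow> complex) \<Rightarrow> real ^ 'n \<Rightarrow> ennreal" where
  "riesz_majorant \<gamma> f x = (\<integral>\<^sup>+y. ennreal (norm (riesz_integrand \<gamma> f x y)) \<partial>lebesgue)"

lemma norm_riesz_integrand:
  fixes x y :: "real ^ 'n"
  shows "norm (riesz_integrand \<gamma> f x y) = norm (f y) / norm (x - y) powr (real CARD('n) - \<gamma>)"
  by (simp add: riesz_integrand_def norm_divide)

text \<open>
  The scales \<open>l / 2^j\<close> for \<open>j \<ge> 0\<close> and \<open>l 2^j\<close> for \<open>j \<ge> 1\<close> are listed in two separate series because they
  are estimated by different arguments.
\<close>

lemma riesz_majorant_le_dyadic: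
  fixes x :: "real ^ 'n"
  assumes [measurable]: "f \<in> borel_measurable lebesgue" and \<gamma>: "\<gamma> < real CARD('n)" and l: "0 < l"
  defines "A \<equiv> (\<lambda>s. ennreal (s powr (\<gamma> - real CARD('n))) * (\<integral>\<^sup>+y\<in>cube x s. ennreal (norm (f y)) \<partial>lebesgue))"
  shows "riesz_majorant \<gamma> f x \<le> ennreal (4 powr (real CARD('n) - \<gamma>)) *
           ((\<Sum>j. A (l / 2 ^ j)) + (\<Sum>j. A (l * 2 ^ Suc j)))"
proof -
  let ?g = "real CARD('n) - \<gamma>"
  define G where "G = (4::real) powr ?g"
  define T where "T s y = ennreal (G * s powr (- ?g)) * (ennreal (norm (f y)) * indicator (cube x s) y)" for s y
  have T [measurable]: "T s \<in> borel_measurable lebesgue" for s unfolding T_def by measurable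
  have pt: "ennreal (norm (riesz_integrand \<gamma> f x y)) \<le> (\<Sum>j. T (l / 2 ^ j) y) + (\<Sum>j. T (l * 2 ^ Suc j) y)" for y
  proof (cases "x = y")
    case False
    define d where "d = norm (x - y)"
    have d: "0 < d" using False by (simp add: d_def)
    \<comment> \<open>\<open>s\<close> is the scale \<open>l 2^m\<close> with \<open>s / 4 < d \<le> s / 2\<close>, so that \<open>y\<close> lies in the cube \<open>Q(x, s)\<close>.\<close>
    define m :: int where "m = \<lceil>log 2 (2 * d / l)\<rceil>"
    define s where "s = l * 2 powr m"
    have e: "2 powr (log 2 (2 * d / l)) = 2 * d / l" using d l by simp
    have "2 powr (log 2 (2 * d / l)) \<le> 2 powr m" by (simp add: m_def)
    then have "2 * d / l \<le> 2 powr m" unfolding e .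
    moreover have "2 powr (m - 1) < 2 powr (log 2 (2 * d / l))" unfolding m_def by simp linarith
    then have "2 powr (m - 1) < 2 * d / l" unfolding e .
    ultimately have ds: "2 * d \<le> s" "s < 4 * d"
      using l by (simp_all add: s_def powr_diff field_simps)
    have s: "0 < s" using l by (simp add: s_def)
    have "y \<in> cube x s" using cball_subset_cube[of x s] ds by (auto simp: dist_norm d_def)
    moreover have "1 / d powr ?g \<le> G * s powr (- ?g)"
    proof -
      have "(s / 4) powr ?g \<le> d powr ?g" using ds s \<gamma> by (intro powr_mono2) auto
      then have "1 / d powr ?g \<le> 1 / (s / 4) powr ?g" using s d by (intro divide_left_mono) auto
      also have "\<dots> = G * s powr (- ?g)"
        using s unfolding powr_minus by (simp add: G_def powr_divide field_simps)
      finally show ?thesis .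
    qed
    then have "norm (f y) * (1 / d powr ?g) \<le> norm (f y) * (G * s powr (- ?g))" by (rule mult_left_mono) simp
    then have "ennreal (norm (riesz_integrand \<gamma> f x y)) \<le> ennreal (G * s powr (- ?g) * norm (f y))"
      by (intro ennreal_leI) (simp add: norm_riesz_integrand d_def[symmetric] mult_ac)
    ultimately have T: "ennreal (norm (riesz_integrand \<gamma> f x y)) \<le> T s y"
      by (simp add: T_def ennreal_mult' G_def)
    have sg: "T s y \<le> (\<Sum>j. g j)" if "T s y = g k" for g :: "nat \<Rightarrow> ennreal" and k
      using sum_le_suminf[of g "{k}"] that by (simp add: summableI)
    show ?thesis
    proof (cases "m \<le> 0")
      case True
      then have "s = l / 2 ^ nat (- m)"
        by (simp add: s_def powr_real_of_int divide_inverse)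
      then have "T s y \<le> (\<Sum>j. T (l / 2 ^ j) y)" by (intro sg[of _ "nat (- m)"]) simp
      then show ?thesis using T by (meson add_increasing2 order_trans zero_le)
    next
      case False
      then have "nat m = Suc (nat (m - 1))" by simp
      then have "s = l * 2 ^ Suc (nat (m - 1))"
        using False by (simp add: s_def powr_real_of_int del: power_Suc)
      then have "T s y \<le> (\<Sum>j. T (l * 2 ^ Suc j) y)" by (intro sg[of _ "nat (m - 1)"]) simp
      then show ?thesis using T by (meson add_increasing order_trans zero_le)
    qed
  qed (simp add: norm_riesz_integrand)
  have int: "(\<integral>\<^sup>+y. T s y \<partial>lebesgue) = ennreal G * A s" for s
    unfolding T_def A_def by (subst nn_integral_cmult) (auto simp: G_def ennreal_mult' mult.assoc)
  have "riesz_majorant \<gamma> f x \<le> (\<integral>\<^sup>+y. (\<Sum>j. T (l / 2 ^ j) y) + (\<Sum>j. T (l * 2 ^ Suc j) y) \<partial>lebesgue)"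
    unfolding riesz_majorant_def by (intro nn_integral_mono pt)
  also have "\<dots> = (\<Sum>j. ennreal G * A (l / 2 ^ j)) + (\<Sum>j. ennreal G * A (l * 2 ^ Suc j))"
    by (subst nn_integral_add) (simp_all add: nn_integral_suminf int del: power_Suc)
  also have "\<dots> = ennreal G * ((\<Sum>j. A (l / 2 ^ j)) + (\<Sum>j. A (l * 2 ^ Suc j)))"
    by (simp add: distrib_left ennreal_suminf_cmult del: power_Suc)
  finally show ?thesis by (simp add: G_def)
qed

section \<open>The weak-type estimate for an abstract bump functional\<close>

text \<open>
  \<open>W y l\<close> is a functional of the cube \<open>Q(y, l)\<close> that dominates \<open>w(Q)\<close>, grows at least by the fixed
  factor \<open>\<rho> > 1\<close> when the side is doubled, and for which the local means of \<open>f\<close> obey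
  \<open>l^(\<gamma> - n) \<integral>\<^sub>Q |f| \<le> H W(Q)^(-1/q) (\<integral>\<^sub>Q |f|^p \<nu>)^(1/p)\<close>. These three properties, the doubling of \<open>w\<close>,
  and \<open>0 < w(Q) < \<infinity>\<close> are all that the weak-type estimate uses of the pair of weights. In \<open>cube_estimate\<close>, \<open>b\<close> is any finite upper
  bound of \<open>\<integral>\<^sub>Q |f|^p \<nu>\<close>, which keeps the right-hand side real.
\<close>

locale bump_functional =
  fixes \<gamma> p q \<kappa> \<rho> D H :: real
    and w \<nu> :: "real ^ 'n \<Rightarrow> real" and W :: "real ^ 'n \<Rightarrow> real \<Rightarrow> real"
  assumes exponents: "\<gamma> < real CARD('n)" "1 < p" "p < q" "0 < \<kappa>" "\<kappa> < p / q"
    and \<rho>: "1 < \<rho>" and D: "0 < D" and H: "0 < H"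
    and w [measurable]: "w \<in> borel_measurable lebesgue"
    and \<nu> [measurable]: "\<nu> \<in> borel_measurable lebesgue"
    and wmeas_cube_pos: "0 < l \<Longrightarrow> 0 < wmeas w (cube y l)"
    and wmeas_cube_finite: "wmeas w (cube y l) < \<infinity>"
    and wmeas_dilated: "0 < l \<Longrightarrow> wmeas w (dilated_cube 2 y l) \<le> ennreal D * wmeas w (cube y l)"
    and wmeas_le_W: "0 < l \<Longrightarrow> wmeas w (cube y l) \<le> ennreal (W y l)"
    and W_growth: "0 < l \<Longrightarrow> \<rho> * W y l \<le> W y (2 * l)"
    and cube_estimate: "\<And>(f :: real ^ 'n \<Rightarrow> complex) y l b. f \<in> borel_measurable lebesgue \<Longrightarrow> 0 < l \<Longrightarrow> 0 \<le> b \<Longrightarrow>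
         (\<integral>\<^sup>+x\<in>cube y l. ennreal (norm (f x) powr p * \<nu> x) \<partial>lebesgue) \<le> ennreal b \<Longrightarrow>
         ennreal (l powr (\<gamma> - real CARD('n))) * (\<integral>\<^sup>+x\<in>cube y l. ennreal (norm (f x)) \<partial>lebesgue)
           \<le> ennreal (H * W y l powr (- 1 / q) * b powr (1 / p))"
begin

text \<open>
  The weighted measure \<open>w(Q(y, l))\<close> as a real number.
\<close>

definition m :: "real ^ 'n \<Rightarrow> real \<Rightarrow> real" where
  "m y l = enn2real (wmeas w (cube y l))"

text \<open>
  The local energy \<open>\<integral>\<^sub>E |f|^p \<nu>\<close>.
\<close>

definition mass :: "(real ^ 'n \<Rightarrow> complex) \<Rightarrow> (real ^ 'n) set \<Rightarrow> ennreal" where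
  "mass f E = (\<integral>\<^sup>+x\<in>E. ennreal (norm (f x) powr p * \<nu> x) \<partial>lebesgue)"

text \<open>
  The contribution of the scale \<open>s\<close> to the fractional integral at \<open>x\<close>: up to a constant,
  \<open>s^(\<gamma> - n)\<close> is the size of the kernel at distance \<open>s\<close> from \<open>x\<close>.
\<close>

definition riesz_piece :: "(real ^ 'n \<Rightarrow> complex) \<Rightarrow> real ^ 'n \<Rightarrow> real \<Rightarrow> ennreal" where
  "riesz_piece f x s =
     ennreal (s powr (\<gamma> - real CARD('n))) * (\<integral>\<^sup>+y\<in>cube x s. ennreal (norm (f y)) \<partial>lebesgue)"

lemma riesz_piece_le:
  assumes "f \<in> borel_measurable lebesgue" "0 < s" "0 \<le> b" "mass f (cube x s) \<le> ennreal b"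
  shows "riesz_piece f x s \<le> ennreal (H * W x s powr (- 1 / q) * b powr (1 / p))"
  using cube_estimate[OF assms(1-3)] assms(4) by (simp add: riesz_piece_def mass_def)

lemma mass_mono: "E \<subseteq> F \<Longrightarrow> mass f E \<le> mass f F"
  unfolding mass_def by (intro nn_integral_mono) (auto split: split_indicator)

lemma wmeas_cube: "wmeas w (cube y l) = ennreal (m y l)"
  using wmeas_cube_finite[of y l] by (simp add: m_def)

lemma m_pos: "0 < l \<Longrightarrow> 0 < m y l"
  using wmeas_cube_pos[of l y] by (simp add: wmeas_cube)

lemma W_pos: assumes "0 < l" shows "0 < W y l"
  using wmeas_le_W[OF assms, of y] wmeas_cube_pos[OF assms, of y]
  by (metis ennreal_neg le_zero_eq not_le_imp_less not_less_zero)

lemma m_le_W: "0 < l \<Longrightarrow> m y l \<le> W y l"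
  using wmeas_le_W[of l y] W_pos[of l y] by (simp add: wmeas_cube)

lemma m_mono: assumes "0 < l'" "cube y l \<subseteq> cube y' l'" shows "m y l \<le> m y' l'"
  using wmeas_mono[OF assms(2), of w] m_pos[OF assms(1), of y'] by (simp add: wmeas_cube)

text \<open>
  The exponent of decay of the large scales; it is positive because \<open>\<kappa> < p / q\<close>.
\<close>

abbreviation e :: real where "e \<equiv> 1 / q - \<kappa> / p"

lemma e_pos: "0 < e" and q_pos: "0 < q" and p_pos: "0 < p"
  using exponents by (auto simp: field_simps)

text \<open>
  Scales above the side of \<open>Q = Q(y, l)\<close>. The Morrey bound gives energy at most \<open>N^p W^\<kappa>\<close> on each cube, so
  the pieces are at most \<open>H N W^(-e)\<close> and decay geometrically; the first of the cubes already contains \<open>Q\<close>.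
\<close>

lemma far_sum_le:
  assumes f: "f \<in> borel_measurable lebesgue" and N: "0 \<le> N"
    and bnd: "\<And>y l. 0 < l \<Longrightarrow> mass f (cube y l) \<le> ennreal (N powr p * m y l powr \<kappa>)"
    and l: "0 < l" and x: "x \<in> cube y l"
  shows "(\<Sum>j. riesz_piece f x (l * 2 ^ Suc j)) \<le> ennreal (H * N * m y l powr (- e) / (1 - \<rho> powr (- e)))"
proof -
  let ?s = "\<lambda>j. l * 2 ^ Suc j"
  have s: "0 < ?s j" for j using l by simp
  have piece_le: "riesz_piece f x (?s j) \<le> ennreal (H * N * W x (?s j) powr (- e))" for j
  proof -
    let ?W = "W x (?s j)" and ?m = "m x (?s j)"
    have "riesz_piece f x (?s j) \<le> ennreal (H * ?W powr (- 1 / q) * (N powr p * ?m powr \<kappa>) powr (1 / p))"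
      by (rule riesz_piece_le[OF f s _ bnd[OF s]]) simp
    also have "(N powr p * ?m powr \<kappa>) powr (1 / p) = N * ?m powr (\<kappa> / p)"
      using p_pos N by (simp add: powr_mult powr_powr)
    also have "H * ?W powr (- 1 / q) * (N * ?m powr (\<kappa> / p)) \<le> H * ?W powr (- 1 / q) * (N * ?W powr (\<kappa> / p))"
      using H N m_le_W[OF s] m_pos[OF s] exponents p_pos
      by (intro mult_left_mono powr_mono2) (auto simp: less_imp_le)
    also have "\<dots> = H * N * ?W powr (- e)"
      by (simp add: powr_add[symmetric] algebra_simps)
    finally show ?thesis by (simp add: ennreal_leI)
  qed
  have dec: "W x (?s (Suc j)) powr (- e) \<le> \<rho> powr (- e) * W x (?s j) powr (- e)" for j
  proof -
    have "W x (?s (Suc j)) powr (- e) \<le> (\<rho> * W x (?s j)) powr (- e)"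
      using W_growth[OF s, of x j] W_pos[OF s, of x j] \<rho> e_pos
      by (intro powr_mono2') (auto simp: mult_ac)
    then show ?thesis using \<rho> W_pos[OF s, of x j] by (simp add: powr_mult)
  qed
  have th: "0 \<le> \<rho> powr (- e)" "\<rho> powr (- e) < 1" using \<rho> e_pos by (auto intro!: powr_less_one)
  have "(\<Sum>j. riesz_piece f x (?s j)) \<le> (\<Sum>j. ennreal (H * N * W x (?s j) powr (- e)))"
    by (intro suminf_le piece_le summableI)
  also have "\<dots> \<le> ennreal (H * N * W x (?s 0) powr (- e) / (1 - \<rho> powr (- e)))"
  proof (rule suminf_ennreal_le)
    fix k
    show "(\<Sum>j<k. H * N * W x (?s j) powr (- e)) \<le> H * N * W x (?s 0) powr (- e) / (1 - \<rho> powr (- e))"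
      by (rule sum_geometric_decay_le[OF th])
         (use H N mult_left_mono[OF dec, of "H * N"] in \<open>auto simp: mult_ac\<close>)
  qed (use H N in simp)
  also have "\<dots> \<le> ennreal (H * N * m y l powr (- e) / (1 - \<rho> powr (- e)))"
  proof -
    have "y \<in> cube x l" using x by (simp add: mem_cube_commute)
    then have "cube y l \<subseteq> cube x (?s 0)" by (rule cube_subset_cube) simp
    then have "m y l \<le> W x (?s 0)" using m_mono[OF s] m_le_W[OF s] by (meson order_trans)
    then have "W x (?s 0) powr (- e) \<le> m y l powr (- e)"
      using m_pos[OF l, of y] e_pos by (intro powr_mono2') auto
    then show ?thesis using H N th by (intro ennreal_leI divide_right_mono mult_left_mono) auto
  qed
  finally show ?thesis .
qed

text \<open>
  Scales below \<open>l\<close>, in the manner of Hedberg. If the energy of \<open>f\<close> is at most \<open>F^p\<close> on a set that contains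
  all the cubes, and on each single cube at most \<open>(t F)^p W\<close>, then a piece is at most a constant times
  \<open>F t^(p/q) min(u^(-1/q), u^(1/p - 1/q))\<close> with \<open>u = t^p W\<close>. Both exponents have the right sign since \<open>p < q\<close>, so the
  lacunary sum is bounded.
\<close>

lemma near_sum_le:
  obtains C where "0 < C"
    "\<And>f x l S F t. f \<in> borel_measurable lebesgue \<Longrightarrow> 0 < l \<Longrightarrow> 0 < F \<Longrightarrow> 0 < t \<Longrightarrow>
       mass f S \<le> ennreal (F powr p) \<Longrightarrow> (\<And>j. cube x (l / 2 ^ j) \<subseteq> S) \<Longrightarrow>
       (\<And>j. mass f (cube x (l / 2 ^ j)) \<le> ennreal ((t * F) powr p * W x (l / 2 ^ j))) \<Longrightarrow>
       (\<Sum>j. riesz_piece f x (l / 2 ^ j)) \<le> ennreal (C * F * t powr (p / q))"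
proof -
  have ab: "0 < 1 / q" "0 < 1 / p - 1 / q" using exponents by (auto simp: field_simps)
  obtain C where C: "0 < C"
    "\<And>(u::nat \<Rightarrow> real) k. (\<And>j. 0 < u j) \<Longrightarrow> (\<And>j. \<rho> * u (Suc j) \<le> u j) \<Longrightarrow>
       (\<Sum>j<k. min (u j powr (- (1 / q))) (u j powr (1 / p - 1 / q))) \<le> C"
    using sum_lacunary_min_bounded[OF \<rho> ab] by blast
  show thesis
  proof (rule that)
    show "0 < H * C" using H C by simp
    fix f x l S F t
    assume f: "f \<in> borel_measurable lebesgue" and l: "0 < (l::real)" and F: "0 < (F::real)" and t: "0 < (t::real)"
      and S: "mass f S \<le> ennreal (F powr p)" "\<And>j. cube x (l / 2 ^ j) \<subseteq> S"
      and small: "\<And>j. mass f (cube x (l / 2 ^ j)) \<le> ennreal ((t * F) powr p * W x (l / 2 ^ j))"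
    let ?s = "\<lambda>j. l / 2 ^ j"
    have s: "0 < ?s j" for j using l by simp
    define u where "u j = t powr p * W x (?s j)" for j
    define c where "c = H * F * t powr (p / q)"
    have c: "0 \<le> c" using H F by (simp add: c_def)
    have u: "0 < u j" for j using W_pos[OF s] t by (simp add: u_def)
    have lac: "\<rho> * u (Suc j) \<le> u j" for j
      using W_growth[OF s, of x "Suc j"] t by (simp add: u_def mult.left_commute)
    have piece_le: "riesz_piece f x (?s j) \<le> ennreal (c * min (u j powr (- (1 / q))) (u j powr (1 / p - 1 / q)))" for j
    proof -
      let ?W = "W x (?s j)"
      have W: "0 < ?W" by (rule W_pos[OF s])
      have "riesz_piece f x (?s j) \<le> ennreal (H * ?W powr (- 1 / q) * (F powr p) powr (1 / p))"
        by (rule riesz_piece_le[OF f s]) (use mass_mono[OF S(2), of f j] S(1) in \<open>auto intro: order_trans\<close>)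
      also have "H * ?W powr (- 1 / q) * (F powr p) powr (1 / p) = c * u j powr (- (1 / q))"
        using p_pos F t W
        by (simp add: c_def u_def powr_mult powr_powr powr_add[symmetric] algebra_simps)
      finally have 1: "riesz_piece f x (?s j) \<le> ennreal (c * u j powr (- (1 / q)))" .
      have "riesz_piece f x (?s j) \<le> ennreal (H * ?W powr (- 1 / q) * ((t * F) powr p * ?W) powr (1 / p))"
        by (rule riesz_piece_le[OF f s _ small]) (use W in simp)
      also have "H * ?W powr (- 1 / q) * ((t * F) powr p * ?W) powr (1 / p) = H * (t * F) * ?W powr (1 / p - 1 / q)"
        using p_pos F t W powr_add[of ?W "- 1 / q" "1 / p"] by (simp add: powr_mult powr_powr mult_ac)
      also have "\<dots> = c * u j powr (1 / p - 1 / q)"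
      proof -
        have "t powr (p / q) * (t powr p) powr (1 / p - 1 / q) = t powr (p / q + p * (1 / p - 1 / q))"
          by (simp add: powr_powr powr_add)
        also have "p / q + p * (1 / p - 1 / q) = 1" using p_pos by (simp add: field_simps)
        finally have "t powr (p / q) * (t powr p) powr (1 / p - 1 / q) = t" using t by simp
        then have "c * u j powr (1 / p - 1 / q) = H * F * t * ?W powr (1 / p - 1 / q)"
          using t W by (simp add: c_def u_def powr_mult mult_ac)
        then show ?thesis by (simp add: mult_ac)
      qed
      finally have 2: "riesz_piece f x (?s j) \<le> ennreal (c * u j powr (1 / p - 1 / q))" .
      show ?thesis using 1 2 by (simp add: min_def)
    qed
    have "(\<Sum>j. riesz_piece f x (?s j)) \<le> (\<Sum>j. ennreal (c * min (u j powr (- (1 / q))) (u j powr (1 / p - 1 / q))))"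
      by (intro suminf_le piece_le summableI)
    also have "\<dots> \<le> ennreal (c * C)"
    proof (rule suminf_ennreal_le)
      fix k
      show "(\<Sum>j<k. c * min (u j powr (- (1 / q))) (u j powr (1 / p - 1 / q))) \<le> c * C"
        using mult_left_mono[OF C(2)[of u, OF u lac] c] by (simp add: sum_distrib_left)
    qed (use c in simp)
    finally show "(\<Sum>j. riesz_piece f x (?s j)) \<le> ennreal (H * C * F * t powr (p / q))"
      by (simp add: c_def mult_ac)
  qed
qed

text \<open>
  For small \<open>\<sigma>\<close> the trivial bound \<open>w(Q)\<close> of the level set suffices. Otherwise the large scales account
  for at most \<open>\<sigma> / 2\<close>, so by \<open>near_sum_le\<close> every point of the level set is the centre of a small cube
  with \<open>(t F)^p W < mass f\<close>. Since \<open>W\<close> dominates \<open>w\<close>, the covering lemma bounds the level set.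
\<close>

lemma weak_type_estimate:
  obtains K where "0 < K"
    "\<And>f N y l \<sigma>. f \<in> borel_measurable lebesgue \<Longrightarrow> 0 \<le> N \<Longrightarrow>
       (\<And>y l. 0 < l \<Longrightarrow> mass f (cube y l) \<le> ennreal (N powr p * m y l powr \<kappa>)) \<Longrightarrow>
       0 < l \<Longrightarrow> 0 < \<sigma> \<Longrightarrow>
       ennreal (\<sigma> powr q) * wmeas w {x \<in> cube y l. ennreal \<sigma> < riesz_majorant \<gamma> f x}
         \<le> ennreal ((K * N) powr q * m y l powr (\<kappa> * q / p))"
proof -
  obtain C where C: "0 < C"
    and near: "\<And>f x l S F t. f \<in> borel_measurable lebesgue \<Longrightarrow> 0 < l \<Longrightarrow> 0 < F \<Longrightarrow> 0 < t \<Longrightarrow>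
       mass f S \<le> ennreal (F powr p) \<Longrightarrow> (\<And>j. cube x (l / 2 ^ j) \<subseteq> S) \<Longrightarrow>
       (\<And>j. mass f (cube x (l / 2 ^ j)) \<le> ennreal ((t * F) powr p * W x (l / 2 ^ j))) \<Longrightarrow>
       (\<Sum>j. riesz_piece f x (l / 2 ^ j)) \<le> ennreal (C * F * t powr (p / q))"
    by (rule near_sum_le) blast
  define G where "G = (4::real) powr (real CARD('n) - \<gamma>)"
  define cf where "cf = H / (1 - \<rho> powr (- e))"
  have G: "0 < G" by (simp add: G_def)
  have "\<rho> powr (- e) < 1" using \<rho> e_pos by (auto intro!: powr_less_one)
  then have cf: "0 < cf" using H by (simp add: cf_def)
  \<comment> \<open>\<open>K1\<close> serves small \<open>\<sigma>\<close> and \<open>K2\<close> large \<open>\<sigma>\<close>.\<close>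
  define K1 where "K1 = 2 * G * cf"
  define K2 where "K2 = D powr (3 / q) * (2 * G * C) * D powr (\<kappa> / p)"
  have K1: "0 < K1" using G cf by (simp add: K1_def)
  have K2: "0 < K2" using G C D by (simp add: K2_def)
  show thesis
  proof (rule that)
    show "0 < max K1 K2" using K1 by simp
    fix f N y l \<sigma>
    assume f [measurable]: "f \<in> borel_measurable lebesgue" and N: "0 \<le> (N::real)"
      and bnd: "\<And>y l. 0 < l \<Longrightarrow> mass f (cube y l) \<le> ennreal (N powr p * m y l powr \<kappa>)"
      and l: "0 < (l::real)" and \<sigma>: "0 < (\<sigma>::real)"
    let ?E = "{x \<in> cube y l. ennreal \<sigma> < riesz_majorant \<gamma> f x}"
    let ?m = "m y l"
    have mp: "0 < ?m" by (rule m_pos[OF l])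
    have reduce: "ennreal ((k * N) powr q * ?m powr (\<kappa> * q / p)) \<le> ennreal ((max K1 K2 * N) powr q * ?m powr (\<kappa> * q / p))"
      if "0 < k" "k \<le> max K1 K2" for k
      using that N q_pos by (intro ennreal_leI mult_right_mono powr_mono2) auto
    \<comment> \<open>\<open>B\<close> bounds the contribution of the large scales at every point of the cube.\<close>
    define B where "B = G * cf * N * ?m powr (- e)"
    have B: "0 \<le> B" using G cf N by (simp add: B_def)
    have split: "riesz_majorant \<gamma> f x \<le> ennreal G * (\<Sum>j. riesz_piece f x (l / 2 ^ j)) + ennreal B" if "x \<in> cube y l" for x
    proof -
      have "riesz_majorant \<gamma> f x \<le> ennreal G * ((\<Sum>j. riesz_piece f x (l / 2 ^ j)) + (\<Sum>j. riesz_piece f x (l * 2 ^ Suc j)))"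
        using riesz_majorant_le_dyadic[OF f exponents(1) l, of x] unfolding riesz_piece_def G_def .
      also have "\<dots> \<le> ennreal G * ((\<Sum>j. riesz_piece f x (l / 2 ^ j)) + ennreal (cf * N * ?m powr (- e)))"
        using far_sum_le[OF f N bnd l that] by (intro mult_left_mono add_mono) (auto simp: cf_def mult_ac)
      also have "\<dots> = ennreal G * (\<Sum>j. riesz_piece f x (l / 2 ^ j)) + ennreal B"
        using G cf N by (simp add: distrib_left B_def ennreal_mult'[symmetric] mult.assoc)
      finally show ?thesis .
    qed
    show "ennreal (\<sigma> powr q) * wmeas w ?E \<le> ennreal ((max K1 K2 * N) powr q * ?m powr (\<kappa> * q / p))"
    proof (cases "\<sigma> \<le> 2 * B")
      case True
      have "ennreal (\<sigma> powr q) * wmeas w ?E \<le> ennreal ((2 * B) powr q) * wmeas w (cube y l)"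
        using True \<sigma> q_pos by (intro mult_mono wmeas_mono ennreal_leI powr_mono2) auto
      also have "\<dots> = ennreal ((2 * B) powr q * ?m)"
        using mp by (simp add: wmeas_cube ennreal_mult)
      also have "(2 * B) powr q * ?m = (K1 * N) powr q * ?m powr (\<kappa> * q / p)"
      proof -
        have "2 * B = K1 * N * ?m powr (- e)" by (simp add: B_def K1_def mult_ac)
        then have "(2 * B) powr q * ?m = (K1 * N) powr q * (?m powr (- e * q) * ?m powr 1)"
          using K1 N mp by (simp add: powr_mult powr_powr)
        also have "?m powr (- e * q) * ?m powr 1 = ?m powr (\<kappa> * q / p)"
          unfolding powr_add[symmetric] using q_pos p_pos by (simp add: field_simps)
        finally show ?thesis .
      qed
      also have "ennreal ((K1 * N) powr q * ?m powr (\<kappa> * q / p)) \<le> ennreal ((max K1 K2 * N) powr q * ?m powr (\<kappa> * q / p))"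
        using K1 by (intro reduce) auto
      finally show ?thesis .
    next
      case False
      let ?S = "cube y (2 * l)"
      \<comment> \<open>\<open>F^p\<close> is the Morrey bound of the energy on the cube \<open>Q(y, 2 l)\<close>, whose weighted measure is at most \<open>D w(Q)\<close>.\<close>
      define F where "F = N * (D * ?m) powr (\<kappa> / p)"
      have F0: "0 \<le> F" using N by (simp add: F_def)
      have near_big: "ennreal (\<sigma> / (2 * G)) < (\<Sum>j. riesz_piece f x (l / 2 ^ j))" if "x \<in> ?E" for x
      proof (rule ccontr)
        assume "\<not> ?thesis"
        then have "ennreal G * (\<Sum>j. riesz_piece f x (l / 2 ^ j)) + ennreal B \<le> ennreal G * ennreal (\<sigma> / (2 * G)) + ennreal B"
          by (intro add_mono mult_left_mono) auto
        also have "\<dots> = ennreal (\<sigma> / 2 + B)"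
          using G \<sigma> B by (simp add: ennreal_mult'[symmetric])
        also have "\<dots> \<le> ennreal \<sigma>" using False by (intro ennreal_leI) auto
        finally show False using split[of x] that by auto
      qed
      have S: "mass f ?S \<le> ennreal (F powr p)"
      proof -
        have m2: "m y (2 * l) \<le> D * ?m"
        proof -
          have "ennreal (m y (2 * l)) \<le> ennreal (D * ?m)"
            using wmeas_dilate_le[OF D wmeas_dilated l, where k = 1 and y = y] D mp
            by (simp add: wmeas_cube ennreal_mult)
          then show ?thesis using D mp by (simp add: ennreal_le_iff)
        qed
        have "mass f ?S \<le> ennreal (N powr p * m y (2 * l) powr \<kappa>)" using l by (intro bnd) simp
        also have "\<dots> \<le> ennreal (N powr p * (D * ?m) powr \<kappa>)"
          using m2 m_pos[of "2 * l" y] l exponents by (intro ennreal_leI mult_left_mono powr_mono2) auto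
        also have "N powr p * (D * ?m) powr \<kappa> = F powr p"
          using N D mp p_pos by (simp add: F_def powr_mult powr_powr)
        finally show ?thesis .
      qed
      have sub: "cube x (l / 2 ^ j) \<subseteq> ?S" if "x \<in> cube y l" for x j
        using that l by (intro cube_subset_cube) (auto simp: field_simps)
      have fin: "ennreal (\<sigma> powr q) * wmeas w ?E \<le> ennreal ((K2 * N) powr q * ?m powr (\<kappa> * q / p))"
      proof (cases "F = 0")
        case True
        have "?E = {}"
        proof (rule ccontr)
          assume "?E \<noteq> {}"
          then obtain x where x: "x \<in> ?E" by blast
          have "riesz_piece f x (l / 2 ^ j) \<le> 0" for j
          proof -
            have "mass f (cube x (l / 2 ^ j)) \<le> ennreal 0"
              using mass_mono[OF sub, of x f j] S True p_pos x by simp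
            then show ?thesis using riesz_piece_le[OF f, of "l / 2 ^ j" 0 x] l by simp
          qed
          then have "(\<Sum>j. riesz_piece f x (l / 2 ^ j)) = 0" by simp
          then show False using near_big[OF x] by simp
        qed
        then show ?thesis by (simp add: wmeas_def)
      next
        case False
        then have F: "0 < F" using F0 by simp
        \<comment> \<open>The value at which the bound of the small scales equals \<open>\<sigma> / (2 G)\<close>.\<close>
        define t where "t = (\<sigma> / (2 * G * C * F)) powr (q / p)"
        have t: "0 < t" using \<sigma> G C F by (simp add: t_def)
        have tq: "C * F * t powr (p / q) = \<sigma> / (2 * G)"
          using \<sigma> G C F p_pos q_pos by (simp add: t_def powr_powr)
        have tp: "(t * F) powr p = \<sigma> powr q / (2 * G * C * F) powr q * F powr p"
          using \<sigma> G C F p_pos by (simp add: t_def powr_powr powr_mult powr_divide)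
        have "ennreal ((t * F) powr p) * wmeas w ?E \<le> ennreal (D ^ 3) * mass f ?S"
          unfolding mass_def
        proof (rule wmeas_le_of_cube_cover[OF w _ D wmeas_dilated])
          fix x assume x: "x \<in> ?E"
          have "\<exists>j. ennreal ((t * F) powr p * W x (l / 2 ^ j)) < mass f (cube x (l / 2 ^ j))"
          proof (rule ccontr)
            assume "\<not> ?thesis"
            then have "(\<Sum>j. riesz_piece f x (l / 2 ^ j)) \<le> ennreal (C * F * t powr (p / q))"
              using x by (intro near[OF f l F t S sub]) (auto simp: not_less)
            then show False using near_big[OF x] unfolding tq by simp
          qed
          then obtain j where j: "ennreal ((t * F) powr p * W x (l / 2 ^ j)) < mass f (cube x (l / 2 ^ j))" ..
          have lj: "0 < l / 2 ^ j" using l by simp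
          have "ennreal ((t * F) powr p) * wmeas w (cube x (l / 2 ^ j)) \<le> ennreal ((t * F) powr p) * ennreal (W x (l / 2 ^ j))"
            by (intro mult_left_mono wmeas_le_W lj) simp
          also have "\<dots> = ennreal ((t * F) powr p * W x (l / 2 ^ j))" by (simp add: ennreal_mult')
          also have "\<dots> \<le> mass f (cube x (l / 2 ^ j))" using j by simp
          finally show "\<exists>s. 0 < s \<and> s \<le> l \<and> cube x s \<subseteq> ?S \<and>
              ennreal ((t * F) powr p) * wmeas w (cube x s) \<le> (\<integral>\<^sup>+y\<in>cube x s. ennreal (norm (f y) powr p * \<nu> y) \<partial>lebesgue)"
            unfolding mass_def using lj l sub[of x j] x by (intro exI[of _ "l / 2 ^ j"]) (auto simp: field_simps)
        qed measurable
        also have "\<dots> \<le> ennreal (D ^ 3) * ennreal (F powr p)" using S by (rule mult_left_mono) simp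
        finally have weak: "ennreal ((t * F) powr p) * wmeas w ?E \<le> ennreal (D ^ 3 * F powr p)"
          using D by (simp add: ennreal_mult)
        let ?c = "(2 * G * C * F) powr q / F powr p"
        have c: "0 \<le> ?c" by simp
        have "ennreal (\<sigma> powr q) * wmeas w ?E = ennreal ?c * (ennreal ((t * F) powr p) * wmeas w ?E)"
        proof -
          have "?c * (t * F) powr p = \<sigma> powr q" unfolding tp using G C F by simp
          then show ?thesis by (simp add: mult.assoc[symmetric] ennreal_mult[symmetric])
        qed
        also have "\<dots> \<le> ennreal ?c * ennreal (D ^ 3 * F powr p)" using weak by (rule mult_left_mono) simp
        also have "\<dots> = ennreal (D ^ 3 * (2 * G * C * F) powr q)"
          using F D by (simp add: ennreal_mult[symmetric])
        also have "D ^ 3 * (2 * G * C * F) powr q = (K2 * N) powr q * ?m powr (\<kappa> * q / p)"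
        proof -
          have "D ^ 3 = (D powr (3 / q)) powr q" using D q_pos powr_realpow[of D 3] by (simp add: powr_powr)
          moreover have "K2 * N * ?m powr (\<kappa> / p) = D powr (3 / q) * (2 * G * C * F)"
            using D mp by (simp add: K2_def F_def powr_mult mult_ac)
          moreover have "(K2 * N) powr q * ?m powr (\<kappa> * q / p) = (K2 * N * ?m powr (\<kappa> / p)) powr q"
            using K2 N by (simp add: powr_mult powr_powr)
          moreover have "(D powr (3 / q) * (2 * G * C * F)) powr q = (D powr (3 / q)) powr q * (2 * G * C * F) powr q"
            using G C F by (simp add: powr_mult)
          ultimately show ?thesis by simp
        qed
        finally show ?thesis .
      qed
      show ?thesis using fin reduce[of K2] K2 by (auto intro: order_trans)
    qed
  qed
qed

end

section \<open>The power-bump condition yields a bump functional\<close>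

lemma epowr_ennreal_pos: "0 < x \<Longrightarrow> epowr (ennreal x) a = ennreal (x powr a)"
  by (simp add: epowr_def ennreal_eq_0_iff not_le)

lemma epowr_ennreal: "0 \<le> x \<Longrightarrow> 0 < a \<Longrightarrow> epowr (ennreal x) a = ennreal (x powr a)"
  by (cases "x = 0") (simp_all add: epowr_ennreal_pos, simp add: epowr_def)

lemma epowr_top: "0 < a \<Longrightarrow> epowr \<infinity> a = \<infinity>"
  by (simp add: epowr_def)

lemma epowr_pos: "0 < a \<Longrightarrow> 0 < x \<Longrightarrow> 0 < epowr x a"
  by (cases x rule: ennreal_cases) (auto simp: epowr_ennreal epowr_top[unfolded infinity_ennreal_def])

lemma epowr_le_ennrealD:
  assumes "0 < a" "0 \<le> b" "epowr x a \<le> ennreal b"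
  shows "x \<le> ennreal (b powr (1 / a))"
proof (cases x rule: ennreal_cases)
  case (real r)
  then have "r powr a \<le> b" using assms by (simp add: epowr_ennreal)
  then have "(r powr a) powr (1 / a) \<le> b powr (1 / a)" using assms real by (intro powr_mono2) auto
  then show ?thesis using real assms by (simp add: powr_powr ennreal_leI)
next
  case top
  then show ?thesis using assms epowr_top[of a] by (simp add: top_unique)
qed

lemma epowr_le_ennrealI:
  assumes "0 < a" "0 \<le> b" "x \<le> ennreal b"
  shows "epowr x a \<le> ennreal (b powr a)"
proof (cases x rule: ennreal_cases)
  case (real r)
  then show ?thesis using assms by (auto simp: epowr_ennreal intro!: ennreal_leI powr_mono2)
next
  case top
  then show ?thesis using assms by (simp add: top_unique)
qed

lemma epowr_measurable [measurable]: "(\<lambda>x. epowr x a) \<in> borel_measurable borel"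
  unfolding epowr_def by measurable

lemma wmeas_cube_finite_of_weight:
  assumes "weight w"
  shows "wmeas w (cube y l) < \<infinity>"
proof -
  have "set_integrable lebesgue (cube y l) w"
    using assms compact_cube by (auto simp: weight_def)
  then have "(\<integral>\<^sup>+x. ennreal (norm (indicator (cube y l) x *\<^sub>R w x)) \<partial>lebesgue) < \<infinity>"
    unfolding set_integrable_def by (simp add: integrable_iff_bounded)
  also have "(\<integral>\<^sup>+x. ennreal (norm (indicator (cube y l) x *\<^sub>R w x)) \<partial>lebesgue) = wmeas w (cube y l)"
    unfolding wmeas_def using assms
    by (intro nn_integral_cong) (auto simp: weight_def split: split_indicator)
  finally show ?thesis .
qed

text \<open>
  A doubling weight that vanishes on one cube vanishes on all its dilates, hence almost everywhere.
\<close>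

lemma doubling_AE_zero_of_null_cube:
  fixes w :: "real ^ 'n \<Rightarrow> real"
  assumes w: "weight w" and dbl: "doubling w" and l: "0 < l" and null: "wmeas w (cube y l) = 0"
  shows "AE x in lebesgue. w x = 0"
proof -
  obtain D where D: "0 < D" "\<And>y l. 0 < l \<Longrightarrow> wmeas w (dilated_cube 2 y l) \<le> ennreal D * wmeas w (cube y l)"
    using dbl unfolding doubling_def by blast
  have [measurable]: "w \<in> borel_measurable lebesgue" and nn: "0 \<le> w x" for x
    using w by (auto simp: weight_def)
  have "AE x in lebesgue. x \<in> cube y (2 ^ k * l) \<longrightarrow> w x = 0" for k
  proof -
    have "wmeas w (cube y (2 ^ k * l)) = 0"
      using wmeas_dilate_le[OF D l, of y k] null by simp
    then have "AE x in lebesgue. ennreal (w x) * indicator (cube y (2 ^ k * l)) x = 0"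
      unfolding wmeas_def by (subst (asm) nn_integral_0_iff_AE) auto
    then show ?thesis by eventually_elim (use nn in \<open>auto simp: ennreal_eq_0_iff intro: order_antisym\<close>)
  qed
  then have "AE x in lebesgue. \<forall>k. x \<in> cube y (2 ^ k * l) \<longrightarrow> w x = 0"
    by (subst AE_all_countable) blast
  then show ?thesis
  proof eventually_elim
    fix x assume *: "\<forall>k. x \<in> cube y (2 ^ k * l) \<longrightarrow> w x = 0"
    obtain k where k: "2 * norm (x - y) / l < 2 ^ k" using real_arch_pow[of 2] by auto
    then have "x \<in> cball y (2 ^ k * l / 2)"
      using l by (simp add: dist_norm norm_minus_commute field_simps)
    then show "w x = 0" using * cball_subset_cube by blast
  qed
qed

lemma ennreal_triple_product_finite:
  fixes a x y :: ennreal
  assumes "0 < a" "0 < x" "0 < y" "a * x * y \<le> ennreal c"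
  shows "x < \<infinity>" "y < \<infinity>"
proof -
  have "a * x * y < \<infinity>" using order_le_less_trans[OF assms(4) ennreal_less_top] by simp
  then show "x < \<infinity>" "y < \<infinity>" using assms(1-3)
    by (auto simp: ennreal_mult_less_top less_top[symmetric] ennreal_mult_eq_top_iff)
qed

text \<open>
  The functional is \<open>W(Q) = |Q|^(1 - 1/r) (\<integral>\<^sub>Q w^r)^(1/r)\<close>. It dominates \<open>w(Q)\<close> by Hoelder's inequality and grows
  because of the factor \<open>|Q|^(1 - 1/r)\<close>; here \<open>r > 1\<close> is used. Since \<open>w(Q) > 0\<close>, the bump condition forces both
  averages to be finite, so that \<open>\<nu> > 0\<close> almost everywhere, and rearranged it bounds
  \<open>l^(\<gamma> - n) (\<integral>\<^sub>Q \<nu>^(-p'/p))^(1/p')\<close> by a multiple of \<open>W(Q)^(-1/q)\<close>; Hoelder's inequality for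
  \<open>|f| = (|f|^p \<nu>)^(1/p) (\<nu>^(-p'/p))^(1/p')\<close> turns this into the estimate of the local means.
\<close>

lemma bump_functional_exists:
  fixes \<gamma> p q \<kappa> :: real and w \<nu> :: "real ^ 'n \<Rightarrow> real"
  assumes \<gamma>: "\<gamma> < real CARD('n)" and p: "1 < p" and q: "p < q" and \<kappa>: "0 < \<kappa>" "\<kappa> < p / q"
    and w: "weight w" and \<nu>: "weight \<nu>" and dbl: "doubling w" and r: "1 < r"
    and cond: "\<And>Q. Q \<in> cubes \<Longrightarrow>
           epowr (emeasure lebesgue Q) (\<gamma> / real CARD('n) + 1 / q - 1 / p)
             * epowr (average (\<lambda>x. epowr (ennreal (w x)) r) Q) (1 / (r * q))
             * epowr (average (\<lambda>x. epowr (ennreal (\<nu> x)) (- conj_exp p / p)) Q) (1 / conj_exp p)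
           \<le> ennreal C"
    and pos: "\<And>y l. 0 < l \<Longrightarrow> 0 < wmeas w (cube y l)"
  shows "\<exists>\<rho> D H W. bump_functional \<gamma> p q \<kappa> \<rho> D H w \<nu> W"
proof -
  let ?n = "real CARD('n)"
  have n: "0 < ?n" by simp
  have p0: "0 < p" and q0: "0 < q" and r0: "0 < r" using p q r by auto
  obtain D where D: "0 < D" "\<And>y l. 0 < l \<Longrightarrow> wmeas w (dilated_cube 2 y l) \<le> ennreal D * wmeas w (cube y l)"
    using dbl unfolding doubling_def by blast
  have [measurable]: "w \<in> borel_measurable lebesgue" and wn: "0 \<le> w x" for x
    using w by (auto simp: weight_def)
  have [measurable]: "\<nu> \<in> borel_measurable lebesgue" and \<nu>n: "0 \<le> \<nu> x" for x
    using \<nu> by (auto simp: weight_def)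
  \<comment> \<open>\<open>s\<close> is \<open>p' / p\<close>.\<close>
  define s where "s = 1 / (p - 1)"
  have s: "conj_exp p / p = s" "0 < s" and c: "1 / conj_exp p = 1 - 1 / p" and c0: "0 < 1 - 1 / p"
    using p by (auto simp: s_def conj_exp_def field_simps)
  define a where "a = \<gamma> / ?n + 1 / q - 1 / p"
  define b where "b = 1 / (r * q)"
  have b0: "0 < b" using r0 q0 by (simp add: b_def)
  define I1 where "I1 y l = (\<integral>\<^sup>+x\<in>cube y l. ennreal (w x powr r) \<partial>lebesgue)" for y l
  define I2 where "I2 y l = (\<integral>\<^sup>+x\<in>cube y l. epowr (ennreal (\<nu> x)) (- s) \<partial>lebesgue)" for y l
  have I1: "0 < I1 y l" if "0 < l" for y l
  proof (rule ccontr)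
    assume "\<not> 0 < I1 y l"
    then have "I1 y l = 0" by (simp add: not_less)
    then have "AE x in lebesgue. ennreal (w x powr r) * indicator (cube y l) x = 0"
      unfolding I1_def by (subst (asm) nn_integral_0_iff_AE) auto
    then have "AE x in lebesgue. ennreal (w x) * indicator (cube y l) x = 0"
      by eventually_elim (use wn in \<open>auto simp: ennreal_eq_0_iff split: split_indicator\<close>)
    then have "wmeas w (cube y l) = 0" unfolding wmeas_def by (subst nn_integral_0_iff_AE) auto
    then show False using pos[OF that, of y] by simp
  qed
  have I2: "0 < I2 y l" if "0 < l" for y l
  proof (rule ccontr)
    assume "\<not> 0 < I2 y l"
    then have "I2 y l = 0" by (simp add: not_less)
    then have "AE x in lebesgue. epowr (ennreal (\<nu> x)) (- s) * indicator (cube y l) x = 0"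
      unfolding I2_def by (subst (asm) nn_integral_0_iff_AE) auto
    moreover have "epowr (ennreal (\<nu> x)) (- s) \<noteq> 0" for x
      using s(2) \<nu>n[of x] by (cases "\<nu> x = 0") (auto simp: epowr_ennreal_pos, simp add: epowr_def)
    ultimately have "AE x in lebesgue. x \<notin> cube y l"
      by (auto elim!: eventually_mono split: split_indicator_asm)
    then have "emeasure lebesgue (cube y l) = 0" by (subst (asm) AE_iff_measurable[OF _ refl]) auto
    then show False using emeasure_cube[OF that, of y] that by simp
  qed
  have key: "ennreal ((l ^ CARD('n)) powr a) * epowr (I1 y l / ennreal (l ^ CARD('n))) b *
      epowr (I2 y l / ennreal (l ^ CARD('n))) (1 - 1 / p) \<le> ennreal C" if l: "0 < l" for y l
  proof -
    have "(\<integral>\<^sup>+x\<in>cube y l. epowr (ennreal (w x)) r \<partial>lebesgue) = I1 y l"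
      unfolding I1_def using wn r0 by (simp add: epowr_ennreal)
    then show ?thesis
      using cond[of "cube y l"] l s
      unfolding average_def a_def[symmetric] b_def[symmetric] c emeasure_cube[OF l] I2_def
      by (auto simp: cubes_def epowr_ennreal_pos)
  qed
  have V: "0 < l ^ CARD('n)" if "0 < l" for l :: real using that by simp
  have fin: "I1 y l < \<infinity>" "I2 y l < \<infinity>" if l: "0 < l" for y l
  proof -
    let ?V = "ennreal (l ^ CARD('n))"
    have q1: "0 < I1 y l / ?V" "0 < I2 y l / ?V"
      using I1[OF l] I2[OF l] by (auto simp: ennreal_divide_eq_0_iff zero_less_iff_neq_zero)
    have "epowr (I1 y l / ?V) b < \<infinity>" "epowr (I2 y l / ?V) (1 - 1 / p) < \<infinity>"
      using ennreal_triple_product_finite[OF _ epowr_pos[OF b0 q1(1)] epowr_pos[OF c0 q1(2)] key[OF l]] l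
      by auto
    then have "I1 y l / ?V \<noteq> \<infinity>" "I2 y l / ?V \<noteq> \<infinity>"
      using epowr_top b0 c0 by auto
    moreover have "\<infinity> / ?V = \<infinity>" by (simp add: ennreal_top_divide)
    ultimately show "I1 y l < \<infinity>" "I2 y l < \<infinity>"
      by (metis infinity_ennreal_def less_top)+
  qed
  define i1 where "i1 y l = enn2real (I1 y l)" for y l
  define i2 where "i2 y l = enn2real (I2 y l)" for y l
  have i1: "I1 y l = ennreal (i1 y l)" "0 < i1 y l" and i2: "I2 y l = ennreal (i2 y l)" "0 < i2 y l" if "0 < l" for y l
    using fin[OF that, of y] I1[OF that, of y] I2[OF that, of y] by (auto simp: i1_def i2_def enn2real_positive_iff)
  define W where "W y l = (l ^ CARD('n)) powr (1 - 1 / r) * i1 y l powr (1 / r)" for y l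
  have W: "0 < W y l" if "0 < l" for y l using i1[OF that, of y] that by (simp add: W_def)
  \<comment> \<open>The constant \<open>C\<close> of the condition need not be positive.\<close>
  define H where "H = max C 1"
  have H: "0 < H" by (simp add: H_def)
  have est: "l powr (\<gamma> - ?n) * i2 y l powr (1 - 1 / p) \<le> H * W y l powr (- 1 / q)" if l: "0 < l" for y l
  proof -
    let ?V = "l ^ CARD('n)"
    have i: "0 < i1 y l" "0 < i2 y l" using i1 i2 l by auto
    have "ennreal (?V powr a * (i1 y l / ?V) powr b * (i2 y l / ?V) powr (1 - 1 / p)) \<le> ennreal C"
      using key[OF l, of y] i V[OF l] i1(1)[OF l] i2(1)[OF l]
      by (simp add: divide_ennreal epowr_ennreal_pos ennreal_mult[symmetric])
    then have "?V powr a * (i1 y l / ?V) powr b * (i2 y l / ?V) powr (1 - 1 / p) \<le> H"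
      by (cases "0 \<le> C") (auto simp: H_def ennreal_le_iff ennreal_neg ennreal_eq_0_iff)
    then have "?V powr a * (i1 y l / ?V) powr b * (i2 y l / ?V) powr (1 - 1 / p) * W y l powr (- 1 / q) \<le> H * W y l powr (- 1 / q)"
      by (rule mult_right_mono) simp
    also have "?V powr a * (i1 y l / ?V) powr b * (i2 y l / ?V) powr (1 - 1 / p) * W y l powr (- 1 / q)
       = l powr (\<gamma> - ?n) * i2 y l powr (1 - 1 / p)"
    proof -
      have lV: "?V = l powr ?n" using l by (simp add: powr_realpow)
      have quot: "(x / ?V) powr d = x powr d * l powr (- ?n * d)" if "0 < x" for x d
        using l that by (simp add: lV powr_divide powr_powr powr_minus_divide)
      have "W y l powr (- 1 / q) = l powr (- ?n * (1 - 1 / r) / q) * i1 y l powr (- b)"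
        using l i q0 r0 by (simp add: W_def lV powr_mult powr_powr b_def)
      moreover have "(i1 y l / ?V) powr b = i1 y l powr b * l powr (- ?n * b)"
        using i by (intro quot) simp
      moreover have "(i2 y l / ?V) powr (1 - 1 / p) = i2 y l powr (1 - 1 / p) * l powr (- ?n * (1 - 1 / p))"
        using i by (intro quot) simp
      moreover have "?V powr a = l powr (?n * a)" by (simp add: lV powr_powr)
      moreover have "i1 y l powr b * i1 y l powr (- b) = 1" using i by (simp add: powr_minus)
      ultimately have "?V powr a * (i1 y l / ?V) powr b * (i2 y l / ?V) powr (1 - 1 / p) * W y l powr (- 1 / q)
        = i2 y l powr (1 - 1 / p) * (l powr (?n * a) * l powr (- ?n * b) * l powr (- ?n * (1 - 1 / p)) * l powr (- ?n * (1 - 1 / r) / q))"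
        by (simp add: mult_ac)
      also have "l powr (?n * a) * l powr (- ?n * b) * l powr (- ?n * (1 - 1 / p)) * l powr (- ?n * (1 - 1 / r) / q)
         = l powr (?n * a + - ?n * b + - ?n * (1 - 1 / p) + - ?n * (1 - 1 / r) / q)"
        by (simp only: powr_add)
      also have "?n * a + - ?n * b + - ?n * (1 - 1 / p) + - ?n * (1 - 1 / r) / q = \<gamma> - ?n"
        using n p0 q0 r0 by (simp add: a_def b_def field_simps)
      finally show ?thesis by (simp add: mult_ac)
    qed
    finally show ?thesis .
  qed
  show ?thesis
  proof (intro exI)
    show "bump_functional \<gamma> p q \<kappa> (2 powr (?n * (1 - 1 / r))) D H w \<nu> W"
    proof
      show "\<gamma> < ?n" "1 < p" "p < q" "0 < \<kappa>" "\<kappa> < p / q" "0 < D" "0 < H" by fact+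
      show "w \<in> borel_measurable lebesgue" "\<nu> \<in> borel_measurable lebesgue" by simp_all
      show "1 < 2 powr (?n * (1 - 1 / r))" using n r by simp
      show "0 < wmeas w (cube y l)" if "0 < l" for y l by (rule pos[OF that])
      show "wmeas w (cube y l) < \<infinity>" for y l by (rule wmeas_cube_finite_of_weight[OF w])
      show "wmeas w (dilated_cube 2 y l) \<le> ennreal D * wmeas w (cube y l)" if "0 < l" for y l by (rule D(2)[OF that])
      show "wmeas w (cube y l) \<le> ennreal (W y l)" if l: "0 < l" for y l
      proof -
        let ?f = "\<lambda>x. w x powr r * indicator (cube y l) x" and ?g = "\<lambda>x. indicator (cube y l) x :: real"
        have "(\<integral>\<^sup>+x. ennreal (?f x powr (1 / r) * ?g x powr (1 - 1 / r)) \<partial>lebesgue)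
            \<le> ennreal (i1 y l powr (1 / r) * (l ^ CARD('n)) powr (1 - 1 / r))"
        proof (rule nn_integral_Holder)
          show "(\<integral>\<^sup>+x. ennreal (?f x) \<partial>lebesgue) \<le> ennreal (i1 y l)"
            using i1(1)[OF l, of y] unfolding I1_def by (simp add: ennreal_mult' ennreal_indicator)
          show "(\<integral>\<^sup>+x. ennreal (?g x) \<partial>lebesgue) \<le> ennreal (l ^ CARD('n))"
            using emeasure_cube[OF l, of y] by (simp add: ennreal_indicator)
        qed (use r l in \<open>auto simp: i1_def\<close>)
        also have "(\<integral>\<^sup>+x. ennreal (?f x powr (1 / r) * ?g x powr (1 - 1 / r)) \<partial>lebesgue) = wmeas w (cube y l)"
          unfolding wmeas_def using r0 wn
          by (intro nn_integral_cong) (auto simp: powr_powr split: split_indicator)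
        finally show ?thesis by (simp add: W_def mult.commute)
      qed
      show "2 powr (?n * (1 - 1 / r)) * W y l \<le> W y (2 * l)" if l: "0 < l" for y l
      proof -
        have "I1 y l \<le> I1 y (2 * l)"
          unfolding I1_def using cube_mono[of l "2 * l" y] l
          by (intro nn_integral_mono) (auto split: split_indicator)
        then have "i1 y l \<le> i1 y (2 * l)"
          using i1[OF l, of y] i1[of "2 * l" y] l by (simp add: ennreal_le_iff)
        then have "i1 y l powr (1 / r) \<le> i1 y (2 * l) powr (1 / r)"
          using i1(2)[OF l, of y] r0 by (intro powr_mono2) auto
        then have "(2 * l ^ 1) powr (?n * (1 - 1 / r)) * i1 y l powr (1 / r) \<le> (2 * l ^ 1) powr (?n * (1 - 1 / r)) * i1 y (2 * l) powr (1 / r)"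
          by (rule mult_left_mono) simp
        moreover have "(k ^ CARD('n)) powr (1 - 1 / r) = k powr (?n * (1 - 1 / r))" if "0 < k" for k :: real
          using that by (simp add: powr_realpow[symmetric] powr_powr del: powr_realpow)
        ultimately show ?thesis using l by (simp add: W_def powr_mult mult.assoc)
      qed
      fix f :: "real ^ 'n \<Rightarrow> complex" and y l B
      assume f [measurable]: "f \<in> borel_measurable lebesgue" and l: "0 < (l::real)" and B: "0 \<le> (B::real)"
        and mass: "(\<integral>\<^sup>+x\<in>cube y l. ennreal (norm (f x) powr p * \<nu> x) \<partial>lebesgue) \<le> ennreal B"
      let ?Q = "cube y l"
      have "AE x in lebesgue. epowr (ennreal (\<nu> x)) (- s) * indicator ?Q x \<noteq> \<infinity>"
        using fin(2)[OF l, of y] unfolding I2_def by (intro nn_integral_noteq_infinite) auto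
      then have \<nu>pos: "AE x in lebesgue. x \<in> ?Q \<longrightarrow> 0 < \<nu> x"
      proof eventually_elim
        fix x assume *: "epowr (ennreal (\<nu> x)) (- s) * indicator ?Q x \<noteq> \<infinity>"
        show "x \<in> ?Q \<longrightarrow> 0 < \<nu> x"
        proof
          assume "x \<in> ?Q"
          then have "epowr (ennreal (\<nu> x)) (- s) \<noteq> \<infinity>" using * by simp
          then have "\<nu> x \<noteq> 0" using s(2) by (auto simp: epowr_def)
          then show "0 < \<nu> x" using \<nu>n[of x] by simp
        qed
      qed
      let ?f = "\<lambda>x. norm (f x) powr p * \<nu> x * indicator ?Q x" and ?g = "\<lambda>x. \<nu> x powr (- s) * indicator ?Q x"
      have "(\<integral>\<^sup>+x\<in>?Q. ennreal (norm (f x)) \<partial>lebesgue) \<le> (\<integral>\<^sup>+x. ennreal (?f x powr (1 / p) * ?g x powr (1 - 1 / p)) \<partial>lebesgue)"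
      proof (rule nn_integral_mono_AE)
        show "AE x in lebesgue. ennreal (norm (f x)) * indicator ?Q x \<le> ennreal (?f x powr (1 / p) * ?g x powr (1 - 1 / p))"
          using \<nu>pos
        proof eventually_elim
          fix x assume x: "x \<in> ?Q \<longrightarrow> 0 < \<nu> x"
          show "ennreal (norm (f x)) * indicator ?Q x \<le> ennreal (?f x powr (1 / p) * ?g x powr (1 - 1 / p))"
          proof (cases "x \<in> ?Q")
            case True
            have "1 / p + - s * (1 - 1 / p) = 0" using p by (simp add: s_def field_simps)
            then have "\<nu> x powr (1 / p) * \<nu> x powr (- s * (1 - 1 / p)) = 1"
              using x True by (simp only: powr_add[symmetric]) simp
            moreover have "?f x powr (1 / p) * ?g x powr (1 - 1 / p) =
                norm (f x) * (\<nu> x powr (1 / p) * \<nu> x powr (- s * (1 - 1 / p)))"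
              using True x p0 by (simp add: powr_mult powr_powr mult_ac)
            ultimately show ?thesis using True by simp
          qed simp
        qed
      qed
      also have "\<dots> \<le> ennreal (B powr (1 / p) * i2 y l powr (1 - 1 / p))"
      proof (rule nn_integral_Holder)
        show "(\<integral>\<^sup>+x. ennreal (?f x) \<partial>lebesgue) \<le> ennreal B"
          using mass by (simp add: ennreal_mult'' ennreal_indicator)
        have "(\<integral>\<^sup>+x. ennreal (?g x) \<partial>lebesgue) \<le> I2 y l"
          unfolding I2_def
        proof (rule nn_integral_mono)
          fix x
          show "ennreal (?g x) \<le> epowr (ennreal (\<nu> x)) (- s) * indicator ?Q x"
            using \<nu>n[of x] by (cases "\<nu> x = 0") (auto simp: epowr_ennreal_pos split: split_indicator)
        qed
        then show "(\<integral>\<^sup>+x. ennreal (?g x) \<partial>lebesgue) \<le> ennreal (i2 y l)" using i2(1)[OF l, of y] by simp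
      qed (use p B \<nu>n in \<open>auto simp: i2_def\<close>)
      finally have "ennreal (l powr (\<gamma> - ?n)) * (\<integral>\<^sup>+x\<in>?Q. ennreal (norm (f x)) \<partial>lebesgue)
          \<le> ennreal (l powr (\<gamma> - ?n)) * ennreal (B powr (1 / p) * i2 y l powr (1 - 1 / p))"
        by (rule mult_left_mono) simp
      also have "\<dots> = ennreal (l powr (\<gamma> - ?n) * i2 y l powr (1 - 1 / p) * B powr (1 / p))"
        by (simp add: ennreal_mult[symmetric] mult_ac)
      also have "\<dots> \<le> ennreal (H * W y l powr (- 1 / q) * B powr (1 / p))"
        by (intro ennreal_leI mult_right_mono est[OF l]) simp
      finally show "ennreal (l powr (\<gamma> - ?n)) * (\<integral>\<^sup>+x\<in>?Q. ennreal (norm (f x)) \<partial>lebesgue)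
          \<le> ennreal (H * W y l powr (- 1 / q) * B powr (1 / p))" .
    qed
  qed
qed

section \<open>Measurability of the fractional integral\<close>

lemma lebesgue_measurable_complex_AE_borel:
  fixes f :: "'a::euclidean_space \<Rightarrow> complex"
  assumes [measurable]: "f \<in> borel_measurable lebesgue"
  obtains g where "g \<in> borel_measurable borel" "AE x in lborel. f x = g x"
proof -
  obtain g1 where g1: "g1 \<in> borel_measurable lborel" "AE x in lborel. Re (f x) = g1 x"
    using completion_ex_borel_measurable_real[of "\<lambda>x. Re (f x)" lborel] by auto
  obtain g2 where g2: "g2 \<in> borel_measurable lborel" "AE x in lborel. Im (f x) = g2 x"
    using completion_ex_borel_measurable_real[of "\<lambda>x. Im (f x)" lborel] by auto
  show thesis
  proof
    show "(\<lambda>x. of_real (g1 x) + \<i> * of_real (g2 x)) \<in> borel_measurable borel" using g1 g2 by simp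
    show "AE x in lborel. f x = of_real (g1 x) + \<i> * of_real (g2 x)"
      using g1(2) g2(2) by eventually_elim (auto simp: complex_eq_iff)
  qed
qed

lemma riesz_integrand_measurable:
  fixes f :: "real ^ 'n \<Rightarrow> complex"
  assumes [measurable]: "f \<in> borel_measurable lebesgue"
  shows "riesz_integrand \<gamma> f x \<in> borel_measurable lebesgue"
proof -
  have [measurable]: "(\<lambda>y. complex_of_real (norm (x - y) powr (real CARD('n) - \<gamma>))) \<in> borel_measurable lebesgue"
    by (rule measurable_completion) measurable
  show ?thesis unfolding riesz_integrand_def[abs_def] by measurable
qed

text \<open>
  Measurability in \<open>x\<close> comes from joint Borel measurability of the integrand, so \<open>f\<close> is first replaced by
  a Borel function that agrees with it almost everywhere; this changes no value of the integrals.
\<close>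

lemma riesz_measurable:
  fixes f :: "real ^ 'n \<Rightarrow> complex"
  assumes f: "f \<in> borel_measurable lebesgue"
  shows "riesz_majorant \<gamma> f \<in> borel_measurable lebesgue" "frac_integral \<gamma> f \<in> borel_measurable lebesgue"
proof -
  obtain g where g [measurable]: "g \<in> borel_measurable borel" and eq: "AE x in lborel. f x = g x"
    by (rule lebesgue_measurable_complex_AE_borel[OF f])
  have gl: "g \<in> borel_measurable lebesgue" using g by (intro measurable_completion) simp
  have AE: "AE y in lebesgue. riesz_integrand \<gamma> f x y = riesz_integrand \<gamma> g x y" for x
    using AE_completion[OF eq] by eventually_elim (simp add: riesz_integrand_def)
  have joint: "(\<lambda>(x, y). riesz_integrand \<gamma> g x y) \<in> borel_measurable (lborel \<Otimes>\<^sub>M lborel)"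
    unfolding riesz_integrand_def by measurable
  have sec: "riesz_integrand \<gamma> g x \<in> borel_measurable lborel" for x
    unfolding riesz_integrand_def[abs_def] by measurable
  have "riesz_majorant \<gamma> f = (\<lambda>x. \<integral>\<^sup>+y. ennreal (norm (riesz_integrand \<gamma> g x y)) \<partial>lborel)"
  proof
    fix x
    have "riesz_majorant \<gamma> f x = (\<integral>\<^sup>+y. ennreal (norm (riesz_integrand \<gamma> g x y)) \<partial>lebesgue)"
      unfolding riesz_majorant_def using AE[of x]
      by (intro nn_integral_cong_AE) (auto elim: eventually_mono)
    then show "riesz_majorant \<gamma> f x = (\<integral>\<^sup>+y. ennreal (norm (riesz_integrand \<gamma> g x y)) \<partial>lborel)"
      by (simp add: nn_integral_completion)
  qed
  moreover have "(\<lambda>x. \<integral>\<^sup>+y. ennreal (norm (riesz_integrand \<gamma> g x y)) \<partial>lborel) \<in> borel_measurable lborel"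
    using joint by (intro lborel.borel_measurable_nn_integral) (auto simp: split_beta')
  ultimately show "riesz_majorant \<gamma> f \<in> borel_measurable lebesgue"
    by (simp add: measurable_completion)
  have "frac_integral \<gamma> f = (\<lambda>x. of_real (1 / riesz_const CARD('n) \<gamma>) * (LINT y|lborel. riesz_integrand \<gamma> g x y))"
  proof
    fix x
    have "(LINT y|lebesgue. riesz_integrand \<gamma> f x y) = (LINT y|lebesgue. riesz_integrand \<gamma> g x y)"
      by (rule integral_cong_AE) (use AE[of x] riesz_integrand_measurable f gl in auto)
    also have "\<dots> = (LINT y|lborel. riesz_integrand \<gamma> g x y)" by (rule integral_completion) (rule sec)
    finally show "frac_integral \<gamma> f x = of_real (1 / riesz_const CARD('n) \<gamma>) * (LINT y|lborel. riesz_integrand \<gamma> g x y)"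
      by (simp add: frac_integral_def)
  qed
  moreover have "(\<lambda>x. LINT y|lborel. riesz_integrand \<gamma> g x y) \<in> borel_measurable lborel"
    by (rule lborel.borel_measurable_lebesgue_integral) (rule joint)
  then have "(\<lambda>x. of_real (1 / riesz_const CARD('n) \<gamma>) * (LINT y|lborel. riesz_integrand \<gamma> g x y)) \<in> borel_measurable lborel"
    by measurable
  ultimately show "frac_integral \<gamma> f \<in> borel_measurable lebesgue" by (simp add: measurable_completion)
qed

text \<open>
  This holds at every point: where the integral diverges, the Bochner integral is \<open>0\<close>.
\<close>

lemma norm_frac_integral_le:
  fixes f :: "real ^ 'n \<Rightarrow> complex"
  shows "ennreal (norm (frac_integral \<gamma> f x)) \<le> ennreal \<bar>1 / riesz_const CARD('n) \<gamma>\<bar> * riesz_majorant \<gamma> f x"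
proof -
  have "ennreal (norm (LINT y|lebesgue. riesz_integrand \<gamma> f x y)) \<le> riesz_majorant \<gamma> f x"
    unfolding riesz_majorant_def
    by (cases "integrable lebesgue (riesz_integrand \<gamma> f x)")
       (auto intro: integral_norm_bound_ennreal simp: not_integrable_integral_eq)
  then have "ennreal \<bar>1 / riesz_const CARD('n) \<gamma>\<bar> * ennreal (norm (LINT y|lebesgue. riesz_integrand \<gamma> f x y))
      \<le> ennreal \<bar>1 / riesz_const CARD('n) \<gamma>\<bar> * riesz_majorant \<gamma> f x" by (rule mult_left_mono) simp
  then show ?thesis by (simp add: frac_integral_def norm_mult ennreal_mult'[symmetric] norm_divide)
qed

lemma frac_integral_definedI:
  assumes "f \<in> borel_measurable lebesgue" "riesz_majorant \<gamma> f x < \<infinity>"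
  shows "frac_integral_defined \<gamma> f x"
  using assms unfolding frac_integral_defined_def riesz_majorant_def
  by (simp add: integrable_iff_bounded riesz_integrand_measurable)

section \<open>From the weak-type estimate to Morrey norms\<close>

context bump_functional
begin

lemma mass_le_of_morrey_norm:
  assumes N: "0 \<le> N" "morrey_norm p \<kappa> \<nu> w f \<le> ennreal N" and l: "0 < l"
  shows "mass f (cube y l) \<le> ennreal (N powr p * m y l powr \<kappa>)"
proof -
  have mp: "0 < m y l" by (rule m_pos[OF l])
  have "epowr (1 / epowr (wmeas w (cube y l)) \<kappa> * mass f (cube y l)) (1 / p) \<le> ennreal N"
    using N(2) l unfolding morrey_norm_def SUP_le_iff cubes_def mass_def by blast
  then have "1 / epowr (wmeas w (cube y l)) \<kappa> * mass f (cube y l) \<le> ennreal (N powr p)"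
    using epowr_le_ennrealD[of "1 / p" N] N(1) p_pos by fastforce
  then have "ennreal (1 / m y l powr \<kappa>) * mass f (cube y l) \<le> ennreal (N powr p)"
    using mp by (simp add: wmeas_cube epowr_ennreal_pos divide_ennreal[symmetric])
  then have "ennreal (m y l powr \<kappa>) * (ennreal (1 / m y l powr \<kappa>) * mass f (cube y l)) \<le> ennreal (m y l powr \<kappa>) * ennreal (N powr p)"
    by (rule mult_left_mono) simp
  then show ?thesis using mp by (simp add: mult.assoc[symmetric] ennreal_mult[symmetric] mult.commute)
qed

text \<open>
  Letting \<open>\<sigma> \<rightarrow> \<infinity>\<close> in the weak-type estimate shows that the majorant is finite almost everywhere with
  respect to \<open>w\<close>, which gives the second conclusion.
\<close>

lemma frac_integral_bounds:
  obtains K where "0 < K"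
    "\<And>f N. f \<in> borel_measurable lebesgue \<Longrightarrow> 0 \<le> N \<Longrightarrow> morrey_norm p \<kappa> \<nu> w f \<le> ennreal N \<Longrightarrow>
       weak_morrey_norm q (\<kappa> * q / p) w (frac_integral \<gamma> f) \<le> ennreal (K * N)"
    "\<And>f N. f \<in> borel_measurable lebesgue \<Longrightarrow> 0 \<le> N \<Longrightarrow> morrey_norm p \<kappa> \<nu> w f \<le> ennreal N \<Longrightarrow>
       AE x in density lebesgue (\<lambda>x. ennreal (w x)). frac_integral_defined \<gamma> f x"
proof -
  obtain K where K: "0 < K" and weak: "\<And>f N y l \<sigma>. f \<in> borel_measurable lebesgue \<Longrightarrow> 0 \<le> N \<Longrightarrow>
       (\<And>y l. 0 < l \<Longrightarrow> mass f (cube y l) \<le> ennreal (N powr p * m y l powr \<kappa>)) \<Longrightarrow>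
       0 < l \<Longrightarrow> 0 < \<sigma> \<Longrightarrow>
       ennreal (\<sigma> powr q) * wmeas w {x \<in> cube y l. ennreal \<sigma> < riesz_majorant \<gamma> f x}
         \<le> ennreal ((K * N) powr q * m y l powr (\<kappa> * q / p))"
    by (rule weak_type_estimate) blast
  have level: "wmeas w {x \<in> cube y l. ennreal \<sigma> < riesz_majorant \<gamma> f x} \<le> ennreal ((K * N / \<sigma> * m y l powr (\<kappa> / p)) powr q)"
    if f: "f \<in> borel_measurable lebesgue" and N: "0 \<le> N" "morrey_norm p \<kappa> \<nu> w f \<le> ennreal N"
      and l: "0 < l" and \<sigma>: "0 < \<sigma>" for f N y l \<sigma>
  proof -
    let ?E = "{x \<in> cube y l. ennreal \<sigma> < riesz_majorant \<gamma> f x}"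
    have "ennreal (1 / \<sigma> powr q) * (ennreal (\<sigma> powr q) * wmeas w ?E)
        \<le> ennreal (1 / \<sigma> powr q) * ennreal ((K * N) powr q * m y l powr (\<kappa> * q / p))"
      by (intro mult_left_mono weak f N(1) mass_le_of_morrey_norm[OF N] l \<sigma>) simp_all
    moreover have "ennreal (1 / \<sigma> powr q) * (ennreal (\<sigma> powr q) * wmeas w ?E) = wmeas w ?E"
      using \<sigma> by (simp add: mult.assoc[symmetric] ennreal_mult[symmetric])
    moreover have "1 / \<sigma> powr q * ((K * N) powr q * m y l powr (\<kappa> * q / p)) = (K * N / \<sigma> * m y l powr (\<kappa> / p)) powr q"
      using K N \<sigma> by (simp add: powr_mult powr_divide powr_powr)
    ultimately show ?thesis by (simp add: ennreal_mult[symmetric])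
  qed
  \<comment> \<open>The summand \<open>1\<close> makes \<open>c\<close> positive without any knowledge of the sign of the Riesz constant.\<close>
  define c where "c = \<bar>1 / riesz_const CARD('n) \<gamma>\<bar> + 1"
  have c: "0 < c" unfolding c_def by (intro add_nonneg_pos) simp_all
  show thesis
  proof (rule that)
    show "0 < K * c" using K c by simp
    fix f N
    assume f: "f \<in> borel_measurable lebesgue" and N: "0 \<le> N" "morrey_norm p \<kappa> \<nu> w f \<le> ennreal N"
    note [measurable] = riesz_measurable(1)[OF f]
    show "weak_morrey_norm q (\<kappa> * q / p) w (frac_integral \<gamma> f) \<le> ennreal (K * c * N)"
      unfolding weak_morrey_norm_def
    proof (intro SUP_least)
      fix Q \<sigma> assume "Q \<in> (cubes :: (real ^ 'n) set set)" and "\<sigma> \<in> {0::real<..}"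
      then obtain y l where Q: "Q = cube y l" "0 < l" and \<sigma>: "0 < \<sigma>" by (auto simp: cubes_def)
      have mp: "0 < m y l" by (rule m_pos[OF Q(2)])
      have mult3: "ennreal a * ennreal b * ennreal d = ennreal (a * b * d)" if "0 \<le> a" "0 \<le> b" "0 \<le> d" for a b d
        using that by (simp add: ennreal_mult)
      let ?b = "K * N / (\<sigma> / c) * m y l powr (\<kappa> / p)"
      have "{x \<in> Q. \<sigma> < norm (frac_integral \<gamma> f x)} \<subseteq> {x \<in> cube y l. ennreal (\<sigma> / c) < riesz_majorant \<gamma> f x}"
      proof safe
        fix x assume x: "x \<in> Q" "\<sigma> < norm (frac_integral \<gamma> f x)"
        show "x \<in> cube y l" using x Q by simp
        have "ennreal (norm (frac_integral \<gamma> f x)) \<le> ennreal c * riesz_majorant \<gamma> f x"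
          by (rule order_trans[OF norm_frac_integral_le]) (intro mult_right_mono ennreal_leI, simp_all add: c_def)
        then have "ennreal \<sigma> < ennreal c * riesz_majorant \<gamma> f x"
          using x(2) \<sigma> by (meson ennreal_lessI order_less_le_trans less_trans)
        moreover have "ennreal c * riesz_majorant \<gamma> f x \<le> ennreal \<sigma>" if "riesz_majorant \<gamma> f x \<le> ennreal (\<sigma> / c)"
          using mult_left_mono[OF that, of "ennreal c"] c \<sigma> by (simp add: ennreal_mult[symmetric])
        ultimately show "ennreal (\<sigma> / c) < riesz_majorant \<gamma> f x" by (meson leD not_le_imp_less)
      qed
      then have "wmeas w {x \<in> Q. \<sigma> < norm (frac_integral \<gamma> f x)} \<le> ennreal (?b powr q)"
        using level[OF f N Q(2), of "\<sigma> / c" y] c \<sigma> by (auto intro: order_trans wmeas_mono)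
      then have "epowr (wmeas w {x \<in> Q. \<sigma> < norm (frac_integral \<gamma> f x)}) (1 / q) \<le> ennreal ((?b powr q) powr (1 / q))"
        using q_pos by (intro epowr_le_ennrealI) auto
      also have "(?b powr q) powr (1 / q) = ?b" using q_pos K N c \<sigma> by (simp add: powr_powr)
      finally have "1 / epowr (wmeas w Q) (\<kappa> * q / p / q) * ennreal \<sigma> *
          epowr (wmeas w {x \<in> Q. \<sigma> < norm (frac_integral \<gamma> f x)}) (1 / q)
          \<le> 1 / epowr (wmeas w Q) (\<kappa> * q / p / q) * ennreal \<sigma> * ennreal ?b"
        by (rule mult_left_mono) simp
      also have pre: "1 / epowr (wmeas w Q) (\<kappa> * q / p / q) = ennreal (1 / m y l powr (\<kappa> / p))"
        using mp Q q_pos by (simp add: wmeas_cube epowr_ennreal_pos divide_ennreal[symmetric])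
      also have "ennreal (1 / m y l powr (\<kappa> / p)) * ennreal \<sigma> * ennreal ?b = ennreal (1 / m y l powr (\<kappa> / p) * \<sigma> * ?b)"
        by (rule mult3) (use \<sigma> K N c in simp_all)
      also have "1 / m y l powr (\<kappa> / p) * \<sigma> * ?b = K * c * N"
        using mp \<sigma> c by (simp add: field_simps)
      finally show "1 / epowr (wmeas w Q) (\<kappa> * q / p / q) * ennreal \<sigma> *
          epowr (wmeas w {x \<in> Q. \<sigma> < norm (frac_integral \<gamma> f x)}) (1 / q) \<le> ennreal (K * c * N)"
        unfolding pre .
    qed
    have null: "wmeas w {x \<in> cube 0 (real (Suc k)). riesz_majorant \<gamma> f x = \<infinity>} = 0" for k
    proof -
      let ?E = "{x \<in> cube 0 (real (Suc k)). riesz_majorant \<gamma> f x = \<infinity>}" and ?M = "m (0 :: real ^ 'n) (real (Suc k)) powr (\<kappa> / p)"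
      have small: "wmeas w ?E \<le> ennreal \<epsilon>" if \<epsilon>: "0 < \<epsilon>" for \<epsilon>
      proof -
        define \<sigma> where "\<sigma> = (K * N * ?M + 1) / \<epsilon> powr (1 / q)"
        have \<sigma>: "0 < \<sigma>" using K N \<epsilon> by (simp add: \<sigma>_def add_nonneg_pos)
        have "wmeas w ?E \<le> wmeas w {x \<in> cube 0 (real (Suc k)). ennreal \<sigma> < riesz_majorant \<gamma> f x}"
          by (rule wmeas_mono) auto
        also have "\<dots> \<le> ennreal ((K * N / \<sigma> * ?M) powr q)" by (rule level[OF f N _ \<sigma>]) simp
        also have "\<dots> \<le> ennreal ((\<epsilon> powr (1 / q)) powr q)"
        proof (intro ennreal_leI powr_mono2)
          have "K * N * ?M \<le> \<epsilon> powr (1 / q) * \<sigma>" using \<epsilon> by (simp add: \<sigma>_def)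
          then show "K * N / \<sigma> * ?M \<le> \<epsilon> powr (1 / q)" using \<sigma> by (simp add: field_simps)
        qed (use q_pos K N \<sigma> in auto)
        also have "(\<epsilon> powr (1 / q)) powr q = \<epsilon>" using \<epsilon> q_pos by (simp add: powr_powr)
        finally show ?thesis .
      qed
      have "wmeas w ?E \<le> 0"
      proof (rule ennreal_le_epsilon)
        fix \<epsilon> :: real assume "0 < \<epsilon>"
        from small[OF this] show "wmeas w ?E \<le> 0 + ennreal \<epsilon>" by simp
      qed
      then show ?thesis by simp
    qed
    have "AE x in lebesgue. \<forall>k. x \<in> cube 0 (real (Suc k)) \<longrightarrow> riesz_majorant \<gamma> f x = \<infinity> \<longrightarrow> ennreal (w x) = 0"
    proof (subst AE_all_countable, rule allI)
      fix k
      have "AE x in lebesgue. ennreal (w x) * indicator {x \<in> cube 0 (real (Suc k)). riesz_majorant \<gamma> f x = \<infinity>} x = 0"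
        using null[of k] unfolding wmeas_def by (subst (asm) nn_integral_0_iff_AE) auto
      then show "AE x in lebesgue. x \<in> cube 0 (real (Suc k)) \<longrightarrow> riesz_majorant \<gamma> f x = \<infinity> \<longrightarrow> ennreal (w x) = 0"
        by eventually_elim auto
    qed
    then have "AE x in lebesgue. 0 < ennreal (w x) \<longrightarrow> frac_integral_defined \<gamma> f x"
    proof eventually_elim
      fix x assume *: "\<forall>k. x \<in> cube 0 (real (Suc k)) \<longrightarrow> riesz_majorant \<gamma> f x = \<infinity> \<longrightarrow> ennreal (w x) = 0"
      obtain k where "x \<in> cube 0 (real (Suc k))" using Union_cubes_nat[of "0 :: real ^ 'n"] by blast
      then show "0 < ennreal (w x) \<longrightarrow> frac_integral_defined \<gamma> f x"
        using * frac_integral_definedI[OF f, of \<gamma> x] by (auto simp: less_top)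
    qed
    then show "AE x in density lebesgue (\<lambda>x. ennreal (w x)). frac_integral_defined \<gamma> f x"
      by (simp add: AE_density)
  qed
qed

end

lemma bounded_operator_ennrealI:
  assumes "0 < K"
    and "\<And>f. f \<in> X \<Longrightarrow> normX f < \<infinity>"
    and "\<And>f. f \<in> X \<Longrightarrow> T f \<in> B"
    and "\<And>f N. f \<in> X \<Longrightarrow> 0 \<le> N \<Longrightarrow> normX f \<le> ennreal N \<Longrightarrow> normY (T f) \<le> ennreal (K * N)"
  shows "bounded_operator T X normX {g \<in> B. normY g < \<infinity>} normY"
proof -
  have bd: "normY (T f) \<le> ennreal K * normX f" if "f \<in> X" for f
  proof -
    have "normX f = ennreal (enn2real (normX f))" using assms(2)[OF that] by simp
    then show ?thesis
      using assms(4)[OF that, of "enn2real (normX f)"] assms(1) by (simp add: ennreal_mult)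
  qed
  have "normY (T f) < \<infinity>" if "f \<in> X" for f
    using bd[OF that] assms(2)[OF that] by (auto intro: order_le_less_trans simp: ennreal_mult_less_top)
  then show ?thesis using bd assms(3) unfolding bounded_operator_def by blast
qed

theorem theorem2p1:
  fixes \<gamma> p q \<kappa> :: real and w \<nu> :: "real ^ 'n \<Rightarrow> real"
  assumes "0 < \<gamma>" and "\<gamma> < real CARD('n)"
    and "1 < p" and "p < q"
    and "0 < \<kappa>" and "\<kappa> < p / q"
    and "weight w" and "weight \<nu>"
    and "\<exists>r>1. \<exists>C::real. \<forall>Q\<in>(cubes :: (real ^ 'n) set set).
           epowr (emeasure lebesgue Q) (\<gamma> / real CARD('n) + 1 / q - 1 / p)
             * epowr (average (\<lambda>x. epowr (ennreal (w x)) r) Q) (1 / (r * q))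
             * epowr (average (\<lambda>x. epowr (ennreal (\<nu> x)) (- conj_exp p / p)) Q) (1 / conj_exp p)
           \<le> ennreal C"
    and "doubling w"
  shows "(\<forall>f \<in> morrey_space p \<kappa> \<nu> w.
            AE x in density lebesgue (\<lambda>x. ennreal (w x)). frac_integral_defined \<gamma> f x) \<and>
         bounded_operator (frac_integral \<gamma>)
           (morrey_space p \<kappa> \<nu> w) (morrey_norm p \<kappa> \<nu> w)
           (weak_morrey_space q (\<kappa> * q / p) w) (weak_morrey_norm q (\<kappa> * q / p) w)"
proof -
  have wm [measurable]: "w \<in> borel_measurable lebesgue" using assms(7) by (simp add: weight_def)
  have f: "f \<in> borel_measurable lebesgue" "morrey_norm p \<kappa> \<nu> w f < \<infinity>" if "f \<in> morrey_space p \<kappa> \<nu> w" for f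
    using that by (auto simp: morrey_space_def Lp_loc_def)
  have "\<exists>K>0. \<forall>f N. f \<in> borel_measurable lebesgue \<longrightarrow> 0 \<le> N \<longrightarrow> morrey_norm p \<kappa> \<nu> w f \<le> ennreal N \<longrightarrow>
      weak_morrey_norm q (\<kappa> * q / p) w (frac_integral \<gamma> f) \<le> ennreal (K * N) \<and>
      (AE x in density lebesgue (\<lambda>x. ennreal (w x)). frac_integral_defined \<gamma> f x)"
  proof (cases "\<forall>y l. 0 < l \<longrightarrow> 0 < wmeas w (cube y l)")
    case True
    from assms(9) obtain r C where "1 < r" and "\<And>Q. Q \<in> (cubes :: (real ^ 'n) set set) \<Longrightarrow>
           epowr (emeasure lebesgue Q) (\<gamma> / real CARD('n) + 1 / q - 1 / p)
             * epowr (average (\<lambda>x. epowr (ennreal (w x)) r) Q) (1 / (r * q))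
             * epowr (average (\<lambda>x. epowr (ennreal (\<nu> x)) (- conj_exp p / p)) Q) (1 / conj_exp p)
           \<le> ennreal C" by blast
    then obtain \<rho> D H W where "bump_functional \<gamma> p q \<kappa> \<rho> D H w \<nu> W"
      using bump_functional_exists[OF assms(2-8,10)] True by blast
    then interpret bump_functional \<gamma> p q \<kappa> \<rho> D H w \<nu> W .
    show ?thesis by (rule frac_integral_bounds) blast
  next
    case False
    \<comment> \<open>Here \<open>w\<close> vanishes almost everywhere, and both conclusions hold for every \<open>f\<close>.\<close>
    then obtain y l where "0 < l" "wmeas w (cube y l) = 0" by (auto simp: not_less)
    then have ae: "AE x in lebesgue. w x = 0" using doubling_AE_zero_of_null_cube assms(7,10) by blast
    have "wmeas w E = 0" for E
    proof -
      have "AE x in lebesgue. ennreal (w x) * indicator E x = 0" using ae by eventually_elim simp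
      from nn_integral_cong_AE[OF this] show ?thesis by (simp add: wmeas_def)
    qed
    then have "weak_morrey_norm q (\<kappa> * q / p) w g \<le> 0" for g
      unfolding weak_morrey_norm_def using assms(3,4) by (intro SUP_least) (simp add: epowr_def)
    moreover have "AE x in density lebesgue (\<lambda>x. ennreal (w x)). P x" for P
      using ae by (subst AE_density) (auto elim: eventually_mono)
    ultimately show ?thesis by (intro exI[of _ 1]) auto
  qed
  then obtain K where "0 < K" and K: "\<And>f N. f \<in> borel_measurable lebesgue \<Longrightarrow> 0 \<le> N \<Longrightarrow>
      morrey_norm p \<kappa> \<nu> w f \<le> ennreal N \<Longrightarrow>
      weak_morrey_norm q (\<kappa> * q / p) w (frac_integral \<gamma> f) \<le> ennreal (K * N) \<and>
      (AE x in density lebesgue (\<lambda>x. ennreal (w x)). frac_integral_defined \<gamma> f x)" by blast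
  show ?thesis
  proof
    show "\<forall>f \<in> morrey_space p \<kappa> \<nu> w.
        AE x in density lebesgue (\<lambda>x. ennreal (w x)). frac_integral_defined \<gamma> f x"
    proof
      fix f assume "f \<in> morrey_space p \<kappa> \<nu> w"
      then show "AE x in density lebesgue (\<lambda>x. ennreal (w x)). frac_integral_defined \<gamma> f x"
        using K[OF f(1), of f "enn2real (morrey_norm p \<kappa> \<nu> w f)"] f(2)[of f] by simp
    qed
    show "bounded_operator (frac_integral \<gamma>)
           (morrey_space p \<kappa> \<nu> w) (morrey_norm p \<kappa> \<nu> w)
           (weak_morrey_space q (\<kappa> * q / p) w) (weak_morrey_norm q (\<kappa> * q / p) w)"
      unfolding weak_morrey_space_def
      using \<open>0 < K\<close> f K riesz_measurable(2) by (intro bounded_operator_ennrealI[of K]) blast+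
  qed
qed

end
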